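(* Let $K$ be a complete non-Archimedean field and let $f(x)=x_0+\lambda(x-x_0)+O((x-x_0)^2)\in K[[x-x_0]]$, where $|\lambda|=1$ and $\lambda$ is not a root of unity. Suppose $f$ is analytically conjugate to $T_\lambda:x\mapsto\lambda x$ on the linearization disc $\Delta_f(x_0)$ in $K$, via a conjugacy function $g$ with $g(x_0)=0$ and $|g'(x_0)|=1$. Suppose that the subset $X\subseteq\Delta_f(x_0)$ satisfies $f(X)\subseteq X$. Then: 1) $f$ is transitive on $X$ if and only if $T_\lambda$ is transitive on $g(X)$; 2) if $X$ is compact and $f$ is transitive on $X$, then $f$ is minimal on $X$; moreover $f(X)=X$ and $g(X)=T_\lambda(g(X))$.
   Context: $K$ is complete with respect to a nontrivial absolute value satisfying $|x+y|\le\max(|x|,|y|)$. The conjugacy function $g$ is a power series in $x-x_0$; the linearization disc $\Delta_f(x_0)$ is the largest disc $U\subseteq K$ containing $x_0$ such that $g$ converges and is one-to-one on $U$ and $g(f(x))=\lambda g(x)$ for all $x\in U$. A map $h:Y\to Y$ is transitive if some $y\in Y$ has forward orbit $\{h^{\circ n}(y)\}_{n\ge0}$ dense in $Y$, and minimal if every forward orbit is dense in $Y$. *)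

theory Defs
  imports "HOL-Analysis.Analysis"
begin

definition nonarch_abs :: "('a::field \<Rightarrow> real) \<Rightarrow> bool" where
  "nonarch_abs av \<longleftrightarrow>
     (\<forall>x. 0 \<le> av x) \<and> (\<forall>x. av x = 0 \<longleftrightarrow> x = 0) \<and>
     (\<forall>x y. av (x * y) = av x * av y) \<and>
     (\<forall>x y. av (x + y) \<le> max (av x) (av y)) \<and>
     (\<exists>x. av x \<noteq> 0 \<and> av x \<noteq> 1)"

definition kdist :: "('a::field \<Rightarrow> real) \<Rightarrow> 'a \<Rightarrow> 'a \<Rightarrow> real" where
  "kdist av x y = av (x - y)"

definition ktop :: "('a::field \<Rightarrow> real) \<Rightarrow> 'a topology" where
  "ktop av = Metric_space.mtopology UNIV (kdist av)"

definition complete_nonarch :: "('a::field \<Rightarrow> real) \<Rightarrow> bool" where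
  "complete_nonarch av \<longleftrightarrow> nonarch_abs av \<and> Metric_space.mcomplete UNIV (kdist av)"

definition ps_sums :: "('a::field \<Rightarrow> real) \<Rightarrow> (nat \<Rightarrow> 'a) \<Rightarrow> 'a \<Rightarrow> 'a \<Rightarrow> 'a \<Rightarrow> bool" where
  "ps_sums av c x0 x s \<longleftrightarrow>
     limitin (ktop av) (\<lambda>n. \<Sum>k<n. c k * (x - x0) ^ k) s sequentially"

definition ps_conv :: "('a::field \<Rightarrow> real) \<Rightarrow> (nat \<Rightarrow> 'a) \<Rightarrow> 'a \<Rightarrow> 'a \<Rightarrow> bool" where
  "ps_conv av c x0 x \<longleftrightarrow> (\<exists>s. ps_sums av c x0 x s)"

definition ps_eval :: "('a::field \<Rightarrow> real) \<Rightarrow> (nat \<Rightarrow> 'a) \<Rightarrow> 'a \<Rightarrow> 'a \<Rightarrow> 'a" where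
  "ps_eval av c x0 x = (THE s. ps_sums av c x0 x s)"

definition is_disc :: "('a::field \<Rightarrow> real) \<Rightarrow> 'a set \<Rightarrow> bool" where
  "is_disc av D \<longleftrightarrow> D = UNIV \<or>
     (\<exists>c r. 0 < r \<and> (D = {x. av (x - c) < r} \<or> D = {x. av (x - c) \<le> r}))"

text \<open>U satisfies the linearization property: f and g converge, g is one-to-one on U,
  and g(f(x)) = lambda g(x) on U.  Here a, b are the coefficients of f, g in powers of (x - x0).\<close>
definition lin_prop ::
  "('a::field \<Rightarrow> real) \<Rightarrow> (nat \<Rightarrow> 'a) \<Rightarrow> (nat \<Rightarrow> 'a) \<Rightarrow> 'a \<Rightarrow> 'a \<Rightarrow> 'a set \<Rightarrow> bool" where
  "lin_prop av a b x0 lam U \<longleftrightarrow>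
     (\<forall>x\<in>U. ps_conv av a x0 x \<and> ps_conv av b x0 x \<and>
             ps_conv av b x0 (ps_eval av a x0 x) \<and>
             ps_eval av b x0 (ps_eval av a x0 x) = lam * ps_eval av b x0 x) \<and>
     inj_on (ps_eval av b x0) U"

definition lin_disc ::
  "('a::field \<Rightarrow> real) \<Rightarrow> (nat \<Rightarrow> 'a) \<Rightarrow> (nat \<Rightarrow> 'a) \<Rightarrow> 'a \<Rightarrow> 'a \<Rightarrow> 'a set \<Rightarrow> bool" where
  "lin_disc av a b x0 lam D \<longleftrightarrow>
     is_disc av D \<and> x0 \<in> D \<and> lin_prop av a b x0 lam D \<and>
     (\<forall>U. is_disc av U \<and> x0 \<in> U \<and> lin_prop av a b x0 lam U \<longrightarrow> U \<subseteq> D)"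

definition transitive_on :: "('a::field \<Rightarrow> real) \<Rightarrow> ('a \<Rightarrow> 'a) \<Rightarrow> 'a set \<Rightarrow> bool" where
  "transitive_on av h Y \<longleftrightarrow>
     (\<exists>y\<in>Y. Y \<subseteq> ktop av closure_of {(h ^^ n) y |n. True})"

definition minimal_on :: "('a::field \<Rightarrow> real) \<Rightarrow> ('a \<Rightarrow> 'a) \<Rightarrow> 'a set \<Rightarrow> bool" where
  "minimal_on av h Y \<longleftrightarrow>
     (\<forall>y\<in>Y. Y \<subseteq> ktop av closure_of {(h ^^ n) y |n. True})"

end

theory Submission
  imports Defs
begin

text \<open>
  Since \<open>K\<close> need not be algebraically closed, injectivity of \<open>g\<close> on \<open>D\<close> does not make \<open>g\<close> an
  isometry, but \<open>f\<close> is one: comparing coefficients in the formal identity \<open>g \<circ> f = \<lambda> g\<close> shows that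
  \<open>f\<close> has Weierstrass degree one on every disc around \<open>x\<^sub>0\<close> on which both series converge. So an orbit
  of \<open>f\<close> is either uniformly discrete or totally bounded.

  Continuity of \<open>g\<close> carries dense orbits from \<open>X\<close> to \<open>g(X)\<close>. Conversely, let the orbit of \<open>g(y)\<close> be
  dense in \<open>g(X)\<close> and \<open>u \<in> X\<close>. If \<open>g(u)\<close> is not on that orbit, then \<open>g - g(u)\<close> takes arbitrarily
  small values at infinitely many points of the orbit of \<open>y\<close>. A divided difference of order \<open>N\<close>,
  the Weierstrass degree of \<open>g - g(u)\<close>, has constant absolute value, so \<open>g - g(u)\<close> cannot be
  arbitrarily small at \<open>N + 1\<close> uniformly separated points. Hence the orbit of \<open>y\<close> is totally bounded,
  by completeness it clusters at some \<open>e\<close> with \<open>g(e) = g(u)\<close>, and \<open>e = u\<close> by injectivity.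
  The compact case only uses that \<open>f\<close> is an isometry.
\<close>

unbundle no vec_syntax
unbundle fps_syntax

text \<open>Only finitely many terms of a null sequence reach a given positive level, so the maximum
  is attained and there is a last index attaining it. For \<open>w k\<close> = |c_k| s^k this index
  is the Weierstrass degree of the series on the closed disc of radius \<open>s\<close>.\<close>

lemma last_maximum:
  fixes w :: "nat \<Rightarrow> real"
  assumes "w \<longlonglongrightarrow> 0" and "0 < w j"
  obtains N where "\<And>k. w k \<le> w N" and "\<And>k. N < k \<Longrightarrow> w k < w N"
proof -
  have fin: "finite {k. v \<le> w k}" if "0 < v" for v
  proof -
    have "eventually (\<lambda>k. w k < v) sequentially"
      using order_tendstoD(2)[OF assms(1) that] .
    then obtain n where "\<And>k. k \<ge> n \<Longrightarrow> w k < v"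
      by (auto simp: eventually_sequentially)
    then have "{k. v \<le> w k} \<subseteq> {..<n}"
      by (force simp flip: not_le)
    then show ?thesis
      using finite_subset by blast
  qed
  define V where "V = Max (w ` {k. w j \<le> w k})"
  have fV: "finite (w ` {k. w j \<le> w k})" and nV: "w j \<in> w ` {k. w j \<le> w k}"
    using fin[OF assms(2)] by auto
  have VwJ: "w j \<le> V"
    unfolding V_def using fV nV by (rule Max_ge)
  have Vmax: "w k \<le> V" for k
  proof (cases "w j \<le> w k")
    case True
    then show ?thesis
      unfolding V_def by (intro Max_ge fV) auto
  qed (use VwJ in linarith)
  have "V \<in> w ` {k. w j \<le> w k}"
    unfolding V_def using fV nV by (intro Max_in) auto
  then obtain i where i: "w i = V" by auto
  have fN: "finite {k. V \<le> w k}"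
    using VwJ assms(2) by (intro fin) linarith
  define N where "N = Max {k. V \<le> w k}"
  have "N \<in> {k. V \<le> w k}"
    unfolding N_def using fN i by (intro Max_in) auto
  then have N: "w N = V"
    using Vmax[of N] by auto
  have "w k < w N" if "N < k" for k
  proof (rule ccontr)
    assume "\<not> w k < w N"
    then have "k \<in> {k. V \<le> w k}"
      using N by simp
    then have "k \<le> N"
      unfolding N_def by (rule Max_ge[OF fN])
    with that show False by simp
  qed
  with N Vmax show ?thesis
    by (intro that[of N]) auto
qed

section \<open>Ultrametric inequalities and limits for the absolute value\<close>

locale nonarch_field =
  fixes av :: "'a::field \<Rightarrow> real"
  assumes nonarch: "nonarch_abs av"
begin

lemma av_nonneg [simp]: "0 \<le> av x"
  and av_eq_0 [simp]: "av x = 0 \<longleftrightarrow> x = 0"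
  and av_mult: "av (x * y) = av x * av y"
  and av_add: "av (x + y) \<le> max (av x) (av y)"
  using nonarch unfolding nonarch_abs_def by auto

lemma av_0 [simp]: "av 0 = 0"
  by simp

lemma av_pos [simp]: "0 < av x \<longleftrightarrow> x \<noteq> 0"
  using av_nonneg[of x] av_eq_0[of x] by linarith

lemma av_1 [simp]: "av 1 = 1"
  using av_mult[of 1 1] by simp

lemma av_minus [simp]: "av (- x) = av x"
proof -
  have "(av (-1))\<^sup>2 = 1"
    using av_mult[of "-1" "-1"] by (simp add: power2_eq_square)
  then have "av (-1) = 1"
    using av_nonneg[of "-1"] by (auto simp: power2_eq_1_iff simp del: av_nonneg)
  then show ?thesis
    using av_mult[of "-1" x] by simp
qed

lemma av_commute: "av (x - y) = av (y - x)"
  using av_minus[of "x - y"] by simp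

lemma av_diff: "av (x - y) \<le> max (av x) (av y)"
  using av_add[of x "- y"] by simp

lemma av_triangle: "av (x - z) \<le> max (av (x - y)) (av (y - z))"
  using av_add[of "x - y" "y - z"] by simp

lemma av_power: "av (x ^ n) = av x ^ n"
  by (induction n) (auto simp: av_mult)

lemma av_add_eq:
  assumes "av y < av x"
  shows "av (x + y) = av x"
  using av_add[of x y] av_diff[of "x + y" y] assms by auto

lemma av_sum_le:
  assumes "\<And>i. i \<in> I \<Longrightarrow> av (u i) \<le> V" and "0 \<le> V"
  shows "av (sum u I) \<le> V"
  using assms(1)
proof (induction I rule: infinite_finite_induct)
  case (insert i I)
  then show ?case
    using av_add[of "u i" "sum u I"] by fastforce
qed (use assms(2) in auto)

lemma av_sum_less:
  assumes "\<And>i. i \<in> I \<Longrightarrow> av (u i) < V" and "0 < V"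
  shows "av (sum u I) < V"
  using assms(1)
proof (induction I rule: infinite_finite_induct)
  case (insert i I)
  then show ?case
    using av_add[of "u i" "sum u I"] by fastforce
qed (use assms(2) in auto)

text \<open>Dominant term principle: the other terms together stay strictly below the largest one,
  so they cannot cancel it.\<close>

lemma av_sum_eq:
  assumes "finite I" and "j \<in> I" and "u j \<noteq> 0"
    and "\<And>i. i \<in> I \<Longrightarrow> i \<noteq> j \<Longrightarrow> av (u i) < av (u j)"
  shows "av (sum u I) = av (u j)"
proof -
  have "sum u I = u j + sum u (I - {j})"
    using assms by (simp add: sum.remove)
  moreover have "av (sum u (I - {j})) < av (u j)"
    using assms by (intro av_sum_less) auto
  ultimately show ?thesis
    using av_add_eq by simp
qed

sublocale Metric_space UNIV "kdist av"
proof
  show "kdist av x z \<le> kdist av x y + kdist av y z" for x y z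
    using av_triangle[of x z y] av_nonneg[of "x - y"] av_nonneg[of "y - z"]
    unfolding kdist_def by linarith
qed (auto simp: kdist_def av_commute)

text \<open>Convergence in \<open>ktop av\<close>, phrased through a real null sequence so that
  limit lemmas for real sequences apply.\<close>

definition conv :: "(nat \<Rightarrow> 'a) \<Rightarrow> 'a \<Rightarrow> bool" where
  "conv v s \<longleftrightarrow> (\<lambda>n. av (v n - s)) \<longlonglongrightarrow> 0"

lemma limitin_iff_conv: "limitin (ktop av) v s sequentially \<longleftrightarrow> conv v s"
  unfolding ktop_def limitin_metric_dist_null conv_def by (simp add: kdist_def)

lemma conv_unique: "conv v s \<Longrightarrow> conv v s' \<Longrightarrow> s = s'"
  using limitin_metric_unique[of v s sequentially s'] limitin_iff_conv[of v]
  by (simp add: ktop_def)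

lemma conv_av:
  assumes "conv v s"
  shows "(\<lambda>n. av (v n)) \<longlonglongrightarrow> av s"
proof -
  have "(\<lambda>n. av (v n) - av s) \<longlonglongrightarrow> 0"
  proof (rule Lim_null_comparison)
    have "\<bar>av (v n) - av s\<bar> \<le> av (v n - s)" for n
      using av_add[of "v n - s" s] av_diff[of "v n" "v n - s"]
        av_nonneg[of s] av_nonneg[of "v n"] av_nonneg[of "v n - s"]
      by (auto simp: max_def simp del: av_nonneg split: if_splits)
    then show "\<forall>\<^sub>F n in sequentially. norm (av (v n) - av s) \<le> av (v n - s)"
      by simp
  qed (use assms in \<open>simp add: conv_def\<close>)
  then show ?thesis
    by (simp add: LIM_zero_iff)
qed

lemma conv_diff:
  assumes "conv v s" and "conv v' s'"
  shows "conv (\<lambda>n. v n - v' n) (s - s')"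
  unfolding conv_def
proof (rule Lim_null_comparison)
  have "av (v n - v' n - (s - s')) \<le> av (v n - s) + av (v' n - s')" for n
    using av_diff[of "v n - s" "v' n - s'"] av_nonneg[of "v n - s"] av_nonneg[of "v' n - s'"]
    unfolding max_def by (auto simp: algebra_simps simp del: av_nonneg split: if_splits)
  then show "\<forall>\<^sub>F n in sequentially. norm (av (v n - v' n - (s - s')))
      \<le> av (v n - s) + av (v' n - s')"
    by simp
  show "(\<lambda>n. av (v n - s) + av (v' n - s')) \<longlonglongrightarrow> 0"
    using tendsto_add[of _ 0 _ _ 0] assms unfolding conv_def by fastforce
qed

lemma conv_const: "conv (\<lambda>n. s) s"
  by (simp add: conv_def)

lemma conv_cong:
  assumes "conv v s" and "eventually (\<lambda>n. v n = v' n) sequentially"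
  shows "conv v' s"
  using assms(1) unfolding conv_def
  by (rule Lim_transform_eventually) (use assms(2) in \<open>auto elim: eventually_mono\<close>)

lemma conv_terms:
  assumes "conv (\<lambda>n. \<Sum>k<n. u k) S"
  shows "(\<lambda>k. av (u k)) \<longlonglongrightarrow> 0"
proof -
  have "conv (\<lambda>n. \<Sum>k<Suc n. u k) S"
    using LIMSEQ_Suc[OF assms[unfolded conv_def]] unfolding conv_def .
  from conv_av[OF conv_diff[OF this assms]] show ?thesis by simp
qed

lemma conv_av_le:
  assumes "conv v s" and "eventually (\<lambda>n. av (v n) \<le> V) sequentially"
  shows "av s \<le> V"
  by (rule tendsto_upperbound[OF conv_av[OF assms(1)] assms(2)]) simp

lemma conv_av_eq:
  assumes "conv v s" and "eventually (\<lambda>n. av (v n) = V) sequentially"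
  shows "av s = V"
  using LIMSEQ_unique[OF conv_av[OF assms(1)]] tendsto_eventually[OF assms(2)] by simp

lemma mem_closure_iff:
  "u \<in> ktop av closure_of S \<longleftrightarrow> (\<forall>\<epsilon>>0. \<exists>v\<in>S. av (v - u) < \<epsilon>)"
  unfolding ktop_def metric_closure_of by (auto simp: kdist_def av_commute)

section \<open>Polynomials dominated by a coefficient\<close>

text \<open>The coefficient \<open>N\<close> is compared only with the higher ones; lower ones may
  be larger. This form passes to divided differences and tolerates a constant term of any size, such
  as \<open>x0\<close> in the series of \<open>f\<close>.\<close>

definition pdom :: "'a poly \<Rightarrow> nat \<Rightarrow> real \<Rightarrow> bool" where
  "pdom p N s \<longleftrightarrow> 0 < s \<and> (\<forall>k>N. av (coeff p k) * s ^ k < av (coeff p N) * s ^ N)"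

lemma pdom_coeff:
  assumes "pdom p N s"
  shows "coeff p N \<noteq> 0"
proof -
  have "0 \<le> av (coeff p (Suc N)) * s ^ Suc N"
    using assms by (simp add: pdom_def)
  also have "\<dots> < av (coeff p N) * s ^ N"
    using assms unfolding pdom_def by blast
  finally show ?thesis by auto
qed

lemma av_poly_pdom_0:
  assumes p: "pdom p 0 s" and x: "av x \<le> s"
  shows "av (poly p x) = av (coeff p 0)"
proof -
  have "av (\<Sum>i\<le>degree p. coeff p i * x ^ i) = av (coeff p 0 * x ^ 0)"
  proof (rule av_sum_eq)
    fix i :: nat assume "i \<noteq> 0"
    then have "av (coeff p i) * s ^ i < av (coeff p 0)"
      using p unfolding pdom_def by auto
    moreover have "av (coeff p i * x ^ i) \<le> av (coeff p i) * s ^ i"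
      unfolding av_mult av_power using x by (intro mult_left_mono power_mono) auto
    ultimately show "av (coeff p i * x ^ i) < av (coeff p 0 * x ^ 0)"
      by simp
  qed (use pdom_coeff[OF p] in auto)
  then show ?thesis
    by (simp add: poly_altdef)
qed

lemma coeff_synthetic_div:
  "coeff (synthetic_div p c) k = coeff p (Suc k) + c * coeff (synthetic_div p c) (Suc k)"
  using arg_cong[OF synthetic_div_correct[of p c], of "\<lambda>q. coeff q (Suc k)"] by simp

text \<open>So \<open>synthetic_div p c\<close> is the first divided difference of \<open>p\<close>
  at \<open>c\<close>.\<close>

lemma poly_synthetic_div: "poly p x - poly p c = (x - c :: 'a) * poly (synthetic_div p c) x"
proof -
  have "poly p x + c * poly (synthetic_div p c) x = poly p c + x * poly (synthetic_div p c) x"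
    using arg_cong[OF synthetic_div_correct[of p c], of "\<lambda>q. poly q x"] by simp
  then have "poly p x = poly p c + x * poly (synthetic_div p c) x - c * poly (synthetic_div p c) x"
    by (simp add: eq_diff_eq)
  then show ?thesis
    by (simp add: left_diff_distrib)
qed

text \<open>By \<open>coeff_synthetic_div\<close> the quotient has coefficients q_k = p_(k+1) + c
  q_(k+1). Descending from the degree of \<open>p\<close>, where q_k vanishes, all q_k with k > N
  stay below the dominant weight; then p_(N+1) dominates in the formula for q_N.\<close>

lemma pdom_synthetic_div:
  assumes p: "pdom p (Suc N) s" and c: "av c \<le> s"
  shows "pdom (synthetic_div p c) N s"
    and "av (coeff (synthetic_div p c) N) = av (coeff p (Suc N))"
proof -
  let ?q = "synthetic_div p c"
  \<comment> \<open>The dominant weight of \<open>p\<close> divided by \<open>s\<close>, because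
    division by x - c lowers exponents by one.\<close>
  let ?V = "av (coeff p (Suc N)) * s ^ N"
  have s: "0 < s" and dom: "\<And>k. Suc N < k \<Longrightarrow> av (coeff p k) * s ^ k < ?V * s"
    using p unfolding pdom_def by (auto simp: ac_simps)
  have V: "0 < ?V"
    using s pdom_coeff[OF p] by simp
  have shift: "av (c * y) * s ^ k \<le> av y * s ^ Suc k" for y k
    unfolding av_mult using c s mult_right_mono[of "av c" s "av y * s ^ k"]
    by (simp add: ac_simps)
  have q: "av (coeff ?q k) * s ^ k < ?V" if "N < k" for k
  proof (cases "k \<le> degree p")
    case False
    then have "coeff ?q k = 0"
      by (intro coeff_eq_0) (simp add: degree_synthetic_div)
    then show ?thesis
      using V by simp
  next
    case True
    then show ?thesis
      using that
    proof (induction k rule: inc_induct)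
      case base
      have "coeff ?q (degree p) = 0"
      proof (cases "degree p = 0")
        case False
        then show ?thesis by (intro coeff_eq_0) (simp add: degree_synthetic_div)
      qed (simp add: synthetic_div_eq_0_iff[THEN iffD2])
      then show ?case
        using V by simp
    next
      case (step k)
      have "av (coeff p (Suc k)) * s ^ k < ?V"
        using dom[of "Suc k"] step.prems s by (simp add: ac_simps)
      moreover have "av (c * coeff ?q (Suc k)) * s ^ k < ?V"
        using shift[of "coeff ?q (Suc k)" k]
          step.IH step.prems by force
      moreover have "av (coeff ?q k) * s ^ k
          \<le> max (av (coeff p (Suc k)) * s ^ k) (av (c * coeff ?q (Suc k)) * s ^ k)"
        unfolding coeff_synthetic_div[of p c k]
        using mult_right_mono[OF av_add[of "coeff p (Suc k)" "c * coeff ?q (Suc k)"], of "s ^ k"] s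
        by (simp add: max_mult_distrib_right)
      ultimately show ?case by linarith
    qed
  qed
  have "av (c * coeff ?q (Suc N)) * s ^ N < ?V"
    using shift[of "coeff ?q (Suc N)" N] q[of "Suc N"] by simp
  then have "av (c * coeff ?q (Suc N)) < av (coeff p (Suc N))"
    using s by simp
  then show eq: "av (coeff ?q N) = av (coeff p (Suc N))"
    unfolding coeff_synthetic_div[of p c N] by (rule av_add_eq)
  show "pdom ?q N s"
    unfolding pdom_def using q s eq by simp
qed

text \<open>Induction by divided differences: choose \<open>c\<close> in \<open>A\<close> and divide
  p - p(c) by x - c. At the remaining points |x - c| is at least \<open>\<epsilon>\<close>, so the
  quotient is at most \<open>\<delta> / \<epsilon>\<close> there, while the dominant coefficient
  keeps its absolute value. After \<open>N\<close> divisions one point is left and the constant term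
  dominates.\<close>

lemma pdom_separated:
  assumes "pdom p N s" and "card A = Suc N" and "\<And>x. x \<in> A \<Longrightarrow> av x \<le> s"
    and "\<And>x y. x \<in> A \<Longrightarrow> y \<in> A \<Longrightarrow> x \<noteq> y \<Longrightarrow> \<epsilon> \<le> av (x - y)" and "0 < \<epsilon>"
    and "\<And>x. x \<in> A \<Longrightarrow> av (poly p x) \<le> \<delta>"
  shows "av (coeff p N) * \<epsilon> ^ N \<le> \<delta>"
  using assms
proof (induction N arbitrary: p A \<delta>)
  case 0
  then obtain x where "x \<in> A"
    by (metis card_1_singletonE One_nat_def insertI1)
  with 0 av_poly_pdom_0[of p s x] show ?case
    by force
next
  case (Suc N)
  then obtain c A' where A: "A = insert c A'" "c \<notin> A'" "card A' = Suc N"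
    by (metis card_eq_SucD)
  let ?q = "synthetic_div p c"
  have "av (coeff ?q N) * \<epsilon> ^ N \<le> \<delta> / \<epsilon>"
  proof (rule Suc.IH[of ?q A'])
    show "pdom ?q N s"
      using Suc.prems A by (intro pdom_synthetic_div) auto
    fix x assume x: "x \<in> A'"
    then have "av (x - c) * av (poly ?q x) \<le> \<delta>"
      using av_diff[of "poly p x" "poly p c"] Suc.prems(6)[of x] Suc.prems(6)[of c] A
      unfolding poly_synthetic_div[of p x c] av_mult by simp
    moreover have "\<epsilon> * av (poly ?q x) \<le> av (x - c) * av (poly ?q x)"
      using Suc.prems(4)[of x c] x A by (intro mult_right_mono) auto
    ultimately show "av (poly ?q x) \<le> \<delta> / \<epsilon>"
      using Suc.prems(5) by (simp add: field_simps)
  qed (use Suc.prems A in auto)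
  moreover have "av (coeff ?q N) = av (coeff p (Suc N))"
    using Suc.prems A by (intro pdom_synthetic_div(2)) auto
  ultimately show ?case
    using Suc.prems(5) by (simp add: field_simps)
qed

section \<open>Formal power series dominated by a coefficient\<close>

text \<open>\<open>gdom A e R V\<close>: the Gauss norm of \<open>A\<close> at radius \<open>R\<close> is \<open>V\<close>, and it is attained for the
  last time at the coefficient \<open>e\<close>, which is the number of zeros of \<open>A\<close> in the closed disc of
  radius \<open>R\<close> over an algebraic closure.\<close>

definition gdom :: "'a fps \<Rightarrow> nat \<Rightarrow> real \<Rightarrow> real \<Rightarrow> bool" where
  "gdom A e R V \<longleftrightarrow> (\<forall>k. av (A $ k) * R ^ k \<le> V) \<and> (\<forall>k>e. av (A $ k) * R ^ k < V) \<and>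
     av (A $ e) * R ^ e = V"

text \<open>Gauss's lemma with the position of the last maximum. In the coefficient
  \<open>e + e'\<close> only the product of the coefficients \<open>e\<close> and \<open>e'\<close>
  reaches \<open>V * V'\<close>; in a higher coefficient each product has a factor beyond its own
  last maximum.\<close>

lemma gdom_mult:
  assumes A: "gdom A e R V" and B: "gdom B e' R V'" and "0 < R" "0 < V" "0 < V'"
  shows "gdom (A * B) (e + e') R (V * V')"
proof -
  have split: "av (A $ i * B $ (k - i)) * R ^ k
      = (av (A $ i) * R ^ i) * (av (B $ (k - i)) * R ^ (k - i))" if "i \<le> k" for i k
    using power_add[of R i "k - i"] that by (simp add: av_mult ac_simps)
  have le: "av (A $ i * B $ (k - i)) * R ^ k \<le> V * V'" if "i \<le> k" for i k
    unfolding split[OF that] using A B assms(3-5) unfolding gdom_def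
    by (intro mult_mono) (auto intro: mult_nonneg_nonneg)
  have strict: "p * q < P * Q" if "p \<le> P" "0 \<le> q" "q < Q" "0 < P" for p q P Q :: real
    using mult_right_mono[OF that(1,2)] mult_strict_left_mono[OF that(3,4)] by linarith
  have less: "av (A $ i * B $ (k - i)) * R ^ k < V * V'" if "i \<le> k" "e < i \<or> e' < k - i" for i k
    using that(2)
  proof
    assume "e < i"
    then have "av (A $ i) * R ^ i < V" "av (B $ (k - i)) * R ^ (k - i) \<le> V'"
      using A B unfolding gdom_def by auto
    then show ?thesis
      unfolding split[OF that(1)] mult.commute[of V] mult.commute[of "av (A $ i) * R ^ i"]
      using assms(3-5) by (intro strict) auto
  next
    assume "e' < k - i"
    then have "av (A $ i) * R ^ i \<le> V" "av (B $ (k - i)) * R ^ (k - i) < V'"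
      using A B unfolding gdom_def by auto
    then show ?thesis
      unfolding split[OF that(1)] using assms(3-5) by (intro strict) auto
  qed
  \<comment> \<open>Moving the weight to the other side leaves a plain absolute value, to which the
    ultrametric bounds for sums apply.\<close>
  have div: "av y * R ^ k \<le> W \<longleftrightarrow> av y \<le> W / R ^ k" "av y * R ^ k < W \<longleftrightarrow> av y < W / R ^ k"
    for y k and W :: real
    using \<open>0 < R\<close> by (auto simp: field_simps)
  have pos: "0 < V * V' / R ^ k" for k
    using assms(3-5) by simp
  have 1: "av ((A * B) $ k) * R ^ k \<le> V * V'" for k
    unfolding fps_mult_nth div using le[unfolded div] pos[of k]
    by (intro av_sum_le) auto
  have 2: "av ((A * B) $ k) * R ^ k < V * V'" if "e + e' < k" for k
    unfolding fps_mult_nth div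
  proof (rule av_sum_less)
    fix i assume "i \<in> {0..k}"
    moreover from this have "e < i \<or> e' < k - i"
      using that by auto
    ultimately show "av (A $ i * B $ (k - i)) < V * V' / R ^ k"
      by (intro less[unfolded div]) auto
  qed (rule pos)
  let ?u = "\<lambda>i. A $ i * B $ (e + e' - i)"
  have e: "av (?u e) * R ^ (e + e') = V * V'"
    using split[of e "e + e'"] A B unfolding gdom_def by simp
  have "av ((A * B) $ (e + e')) = av (?u e)"
    unfolding fps_mult_nth
  proof (rule av_sum_eq)
    fix i assume i: "i \<in> {0..e + e'}" "i \<noteq> e"
    then have "av (?u i) * R ^ (e + e') < av (?u e) * R ^ (e + e')"
      unfolding e by (intro less) auto
    then show "av (?u i) < av (?u e)"
      using \<open>0 < R\<close> by simp
  next
    show "?u e \<noteq> 0"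
    proof
      assume "?u e = 0"
      then have "V * V' = 0"
        using e by (metis av_0 mult_zero_left)
      then show False
        using assms(4,5) by simp
    qed
  qed auto
  with e have 3: "av ((A * B) $ (e + e')) * R ^ (e + e') = V * V'"
    by simp
  show ?thesis
    unfolding gdom_def using 1 2 3 by blast
qed

lemma gdom_power:
  assumes "gdom A e R V" "0 < R" "0 < V"
  shows "gdom (A ^ n) (n * e) R (V ^ n)"
proof (induction n)
  case 0
  then show ?case by (auto simp: gdom_def)
next
  case (Suc n)
  with gdom_mult[OF assms(1) this] assms show ?case by simp
qed

text \<open>Otherwise \<open>F\<close> would have \<open>e > 1\<close> zeros in the disc of some radius \<open>R \<le> s\<close> that it maps to
  itself; there the composition \<open>B oo F\<close> would have \<open>e\<close> times as many zeros as \<open>B\<close>.\<close>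

lemma linearizable_coeff_less:
  assumes semiconj: "B oo F = fps_const lam * B" and lam: "av lam = 1"
    and F: "F $ 0 = 0" "av (F $ 1) = 1" and B: "B $ 0 = 0" "B $ 1 \<noteq> 0" and s: "0 < s"
    and limF: "(\<lambda>k. av (F $ k) * s ^ k) \<longlonglongrightarrow> 0" and limB: "(\<lambda>k. av (B $ k) * s ^ k) \<longlonglongrightarrow> 0"
    and j: "2 \<le> j"
  shows "av (F $ j) * s ^ j < s"
proof (rule ccontr)
  assume neg: "\<not> av (F $ j) * s ^ j < s"
  \<comment> \<open>The indices violating the claim: finitely many, since the weights at radius
    \<open>s\<close> tend to zero, and \<open>j\<close> is among them.\<close>
  define S where "S = {k. 2 \<le> k \<and> s \<le> av (F $ k) * s ^ k}"
  have finS: "finite S"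
  proof -
    obtain n where "\<And>k. n \<le> k \<Longrightarrow> av (F $ k) * s ^ k < s"
      using order_tendstoD(2)[OF limF s] by (auto simp: eventually_sequentially)
    then have "S \<subseteq> {..<n}"
      unfolding S_def by (force simp flip: not_le)
    then show ?thesis
      using finite_subset by blast
  qed
  have jS: "j \<in> S"
    using neg j by (simp add: S_def)
  \<comment> \<open>The critical radius of index \<open>k\<close>, at which |F_k| R^k = R, so that
    the term \<open>k\<close> is as large as the linear term.\<close>
  define rad where "rad k = root (k - 1) (1 / av (F $ k))" for k
  have nz: "F $ k \<noteq> 0" if "k \<in> S" for k
    using that s unfolding S_def by auto
  have rad_pos: "0 < rad k" and rad_pow: "av (F $ k) * rad k ^ (k - 1) = 1" if "k \<in> S" for k
    using that nz[OF that] unfolding rad_def S_def by (auto simp: real_root_pow_pos2)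
  have rad_le: "rad k \<le> s" if "k \<in> S" for k
  proof (rule power_le_imp_le_base[of _ "k - 2"])
    have "s \<le> av (F $ k) * s ^ (k - 1) * s"
      using that power_Suc[of s "k - 1"] unfolding S_def by (simp add: ac_simps)
    then have "1 \<le> av (F $ k) * s ^ (k - 1)"
      using s by simp
    then have "av (F $ k) * rad k ^ (k - 1) \<le> av (F $ k) * s ^ (k - 1)"
      using rad_pow[OF that] by simp
    moreover have "Suc (k - 2) = k - 1"
      using that unfolding S_def by auto
    ultimately show "rad k ^ Suc (k - 2) \<le> s ^ Suc (k - 2)"
      using nz[OF that] by simp
  qed (use s in simp)
  \<comment> \<open>At the smallest critical radius no term exceeds the linear one, yet some term of
    index \<open>i\<close> \<ge> 2 equals it.\<close>
  define R where "R = Min (rad ` S)"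
  have R_le: "R \<le> rad k" if "k \<in> S" for k
    unfolding R_def using finS that by (intro Min_le) auto
  have "R \<in> rad ` S"
    unfolding R_def using finS jS by (intro Min_in) auto
  then obtain i where i: "i \<in> S" "R = rad i" by auto
  then have R: "0 < R" "R \<le> s"
    using rad_pos rad_le by auto
  have pow: "R ^ k = R ^ (k - 1) * R" "s ^ k = s ^ (k - 1) * s" if "0 < k" for k
    using that by (cases k; simp)+
  have F_le: "av (F $ k) * R ^ k \<le> R" for k
  proof -
    consider "k = 0" | "k = 1" | "k \<in> S" | "2 \<le> k" "k \<notin> S" by linarith
    then show ?thesis
    proof cases
      case 3
      then have "av (F $ k) * R ^ (k - 1) \<le> av (F $ k) * rad k ^ (k - 1)"
        using R R_le by (intro mult_left_mono power_mono) auto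
      then have "av (F $ k) * R ^ (k - 1) * R \<le> 1 * R"
        unfolding rad_pow[OF 3] using R by (intro mult_right_mono) auto
      moreover have "0 < k"
        using 3 by (auto simp: S_def)
      ultimately show ?thesis
        by (simp add: pow ac_simps)
    next
      case 4
      then have "av (F $ k) * s ^ (k - 1) * s < 1 * s"
        by (simp add: S_def pow ac_simps)
      then have "av (F $ k) * s ^ (k - 1) < 1"
        using s by simp
      moreover have "av (F $ k) * R ^ (k - 1) \<le> av (F $ k) * s ^ (k - 1)"
        using R by (intro mult_left_mono power_mono) auto
      ultimately have "av (F $ k) * R ^ (k - 1) * R \<le> 1 * R"
        using R by (intro mult_right_mono) auto
      with 4 show ?thesis
        by (simp add: pow ac_simps)
    qed (use F R in auto)
  qed
  have F_i: "av (F $ i) * R ^ i = R"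
    using rad_pow[OF i(1)] i pow(1)[of i] by (simp add: S_def mult.assoc[symmetric])
  have lim_R: "(\<lambda>k. av (A k) * R ^ k) \<longlonglongrightarrow> 0" if "(\<lambda>k. av (A k) * s ^ k) \<longlonglongrightarrow> 0" for A :: "nat \<Rightarrow> 'a"
  proof (rule Lim_null_comparison[OF _ that])
    show "\<forall>\<^sub>F k in sequentially. norm (av (A k) * R ^ k) \<le> av (A k) * s ^ k"
      using R by (auto intro!: always_eventually mult_left_mono power_mono)
  qed
  have "0 < av (F $ 1) * R ^ 1" and "0 < av (B $ 1) * R ^ 1"
    using F B R by auto
  then obtain e N where e: "\<And>k. av (F $ k) * R ^ k \<le> av (F $ e) * R ^ e"
      "\<And>k. e < k \<Longrightarrow> av (F $ k) * R ^ k < av (F $ e) * R ^ e"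
    and N: "\<And>k. av (B $ k) * R ^ k \<le> av (B $ N) * R ^ N"
      "\<And>k. N < k \<Longrightarrow> av (B $ k) * R ^ k < av (B $ N) * R ^ N"
    using last_maximum[OF lim_R[OF limF], of 1] last_maximum[OF lim_R[OF limB], of 1] by metis
  define V where "V = av (B $ N) * R ^ N"
  have V: "0 < V"
    using N(1)[of 1] \<open>0 < av (B $ 1) * R ^ 1\<close> unfolding V_def by linarith
  have e_max: "av (F $ e) * R ^ e = R"
    using e(1)[of i] F_i F_le[of e] by simp
  \<comment> \<open>The index \<open>i\<close> already attains the maximum \<open>R\<close>, so the
    last maximum \<open>e\<close> is not before it.\<close>
  have "2 \<le> e"
  proof (rule ccontr)
    assume "\<not> 2 \<le> e"
    then have "e < i"
      using i by (simp add: S_def)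
    then show False
      using e(2)[of i] F_i e_max by simp
  qed
  have "N \<noteq> 0"
    using V B unfolding V_def by (metis av_0 less_irrefl mult_zero_left)
  have gF: "gdom F e R R"
    unfolding gdom_def using F_le e e_max by metis
  note gFk = gdom_power[OF gF R(1) R(1)]
  let ?m = "N * e"
  \<comment> \<open>In the coefficient \<open>N * e\<close> of the composition the summand
    \<open>N\<close> dominates. For k > N the factor |B_k| R^k is below \<open>V\<close>; for k < N
    the index \<open>N * e\<close> lies beyond the last maximum \<open>k * e\<close> of
    \<open>F ^ k\<close>.\<close>
  have "av ((B oo F) $ ?m) = av (B $ N * (F ^ N) $ ?m)"
    unfolding fps_compose_nth
  proof (rule av_sum_eq)
    have "av (B $ N * (F ^ N) $ ?m) * R ^ ?m = av (B $ N) * (av ((F ^ N) $ ?m) * R ^ ?m)"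
      by (simp add: av_mult)
    also have "\<dots> = V"
      using gFk[of N] unfolding gdom_def V_def by simp
    finally have main: "av (B $ N * (F ^ N) $ ?m) * R ^ ?m = V" .
    then show "B $ N * (F ^ N) $ ?m \<noteq> 0"
      using V by (metis av_0 less_irrefl mult_zero_left)
    fix k assume k: "k \<in> {0..?m}" "k \<noteq> N"
    have "av (B $ k * (F ^ k) $ ?m) * R ^ ?m = av (B $ k) * (av ((F ^ k) $ ?m) * R ^ ?m)"
      by (simp add: av_mult)
    also have "\<dots> < V"
    proof (cases "N < k")
      case True
      have "av (B $ k) * (av ((F ^ k) $ ?m) * R ^ ?m) \<le> av (B $ k) * R ^ k"
        using gFk[of k] unfolding gdom_def by (intro mult_left_mono) auto
      with N(2)[OF True] show ?thesis
        unfolding V_def by simp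
    next
      case False
      then have "k * e < ?m"
        using k \<open>2 \<le> e\<close> by simp
      then have *: "av ((F ^ k) $ ?m) * R ^ ?m < R ^ k"
        using gFk[of k] unfolding gdom_def by blast
      show ?thesis
      proof (cases "B $ k = 0")
        case False
        with * have "av (B $ k) * (av ((F ^ k) $ ?m) * R ^ ?m) < av (B $ k) * R ^ k"
          by (intro mult_strict_left_mono) auto
        with N(1)[of k] show ?thesis
          unfolding V_def by simp
      qed (use V in simp)
    qed
    finally show "av (B $ k * (F ^ k) $ ?m) < av (B $ N * (F ^ N) $ ?m)"
      unfolding main[symmetric] using R by simp
  qed (use \<open>2 \<le> e\<close> in auto)
  \<comment> \<open>By the semiconjugacy and |lam| = 1 the coefficient \<open>N * e\<close> of
    \<open>B\<close> itself has weight \<open>V\<close>, although \<open>N * e\<close> >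
    \<open>N\<close> and \<open>N\<close> was the last maximum.\<close>
  then have "av (B $ ?m) * R ^ ?m = av (B $ N) * (av ((F ^ N) $ ?m) * R ^ ?m)"
    unfolding semiconj by (simp add: av_mult lam)
  also have "\<dots> = V"
    using gFk[of N] unfolding gdom_def V_def by simp
  finally have "\<not> N < ?m"
    using N(2)[of ?m] unfolding V_def by force
  with \<open>N \<noteq> 0\<close> \<open>2 \<le> e\<close> show False by simp
qed

section \<open>Asymptotic expansions at zero\<close>

text \<open>The point \<open>t = 0\<close> is excluded so that a common factor \<open>t\<close> can be cancelled.\<close>

definition bigO :: "nat \<Rightarrow> ('a \<Rightarrow> 'a) \<Rightarrow> bool" where
  "bigO m \<phi> \<longleftrightarrow> (\<exists>r>0. \<exists>C\<ge>0. \<forall>t. t \<noteq> 0 \<longrightarrow> av t \<le> r \<longrightarrow> av (\<phi> t) \<le> C * av t ^ m)"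

lemma bigOI:
  assumes "0 < r" and "\<And>t. t \<noteq> 0 \<Longrightarrow> av t \<le> r \<Longrightarrow> av (\<phi> t) \<le> C * av t ^ m"
  shows "bigO m \<phi>"
proof -
  have "av (\<phi> t) \<le> \<bar>C\<bar> * av t ^ m" if "t \<noteq> 0" "av t \<le> r" for t
    using assms(2)[OF that] mult_right_mono[OF abs_ge_self[of C], of "av t ^ m"] by simp
  then have "0 \<le> \<bar>C\<bar> \<and> (\<forall>t. t \<noteq> 0 \<longrightarrow> av t \<le> r \<longrightarrow> av (\<phi> t) \<le> \<bar>C\<bar> * av t ^ m)"
    by simp
  then show ?thesis
    unfolding bigO_def using assms(1) by blast
qed

lemma bigOE:
  assumes "bigO m \<phi>"
  obtains r C where "0 < r" "0 \<le> C" "\<And>t. t \<noteq> 0 \<Longrightarrow> av t \<le> r \<Longrightarrow> av (\<phi> t) \<le> C * av t ^ m"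
  using assms unfolding bigO_def by blast

lemma bigO_add:
  assumes "bigO m \<phi>" and "bigO m \<psi>"
  shows "bigO m (\<lambda>t. \<phi> t + \<psi> t)"
proof -
  obtain r C where r: "0 < r" "0 \<le> C"
      "\<And>t. t \<noteq> 0 \<Longrightarrow> av t \<le> r \<Longrightarrow> av (\<phi> t) \<le> C * av t ^ m"
    using assms(1) by (rule bigOE) blast
  obtain r' C' where r': "0 < r'" "0 \<le> C'"
      "\<And>t. t \<noteq> 0 \<Longrightarrow> av t \<le> r' \<Longrightarrow> av (\<psi> t) \<le> C' * av t ^ m"
    using assms(2) by (rule bigOE) blast
  show ?thesis
  proof (rule bigOI)
    fix t assume "t \<noteq> 0" "av t \<le> min r r'"
    then have "av (\<phi> t) \<le> C * av t ^ m" "av (\<psi> t) \<le> C' * av t ^ m"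
      using r r' by auto
    moreover have "0 \<le> C * av t ^ m" "0 \<le> C' * av t ^ m"
      using r r' by auto
    ultimately show "av (\<phi> t + \<psi> t) \<le> (C + C') * av t ^ m"
      using av_add[of "\<phi> t" "\<psi> t"] unfolding distrib_right by linarith
  qed (use r r' in simp)
qed

lemma bigO_uminus: "bigO m \<phi> \<Longrightarrow> bigO m (\<lambda>t. - \<phi> t)"
  unfolding bigO_def by simp

lemma bigO_mult:
  assumes "bigO m \<phi>" and "bigO n \<psi>"
  shows "bigO (m + n) (\<lambda>t. \<phi> t * \<psi> t)"
proof -
  obtain r C where r: "0 < r" "0 \<le> C"
      "\<And>t. t \<noteq> 0 \<Longrightarrow> av t \<le> r \<Longrightarrow> av (\<phi> t) \<le> C * av t ^ m"
    using assms(1) by (rule bigOE) blast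
  obtain r' C' where r': "0 < r'" "0 \<le> C'"
      "\<And>t. t \<noteq> 0 \<Longrightarrow> av t \<le> r' \<Longrightarrow> av (\<psi> t) \<le> C' * av t ^ n"
    using assms(2) by (rule bigOE) blast
  show ?thesis
  proof (rule bigOI)
    fix t assume "t \<noteq> 0" "av t \<le> min r r'"
    then have "av (\<phi> t) * av (\<psi> t) \<le> (C * av t ^ m) * (C' * av t ^ n)"
      using r r' by (intro mult_mono) auto
    then show "av (\<phi> t * \<psi> t) \<le> (C * C') * av t ^ (m + n)"
      by (simp add: av_mult power_add ac_simps)
  qed (use r r' in simp)
qed

lemma bigO_const: "bigO 0 (\<lambda>t. c)"
  by (rule bigOI[of 1 _ "av c"]) auto

lemma bigO_ident: "bigO 1 (\<lambda>t. t)"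
  by (rule bigOI[of 1 _ 1]) auto

lemma bigO_mono:
  assumes "bigO n \<phi>" and "m \<le> n"
  shows "bigO m \<phi>"
proof -
  obtain r C where r: "0 < r" "0 \<le> C"
      "\<And>t. t \<noteq> 0 \<Longrightarrow> av t \<le> r \<Longrightarrow> av (\<phi> t) \<le> C * av t ^ n"
    using assms(1) by (rule bigOE) blast
  show ?thesis
  proof (rule bigOI)
    fix t assume t: "t \<noteq> 0" "av t \<le> min r 1"
    then have "C * av t ^ n \<le> C * av t ^ m"
      using r assms(2) by (intro mult_left_mono power_decreasing) auto
    with r(3)[of t] t show "av (\<phi> t) \<le> C * av t ^ m"
      by simp
  qed (use r in simp)
qed

lemma bigO_poly: "bigO 0 (poly p)"
proof (induction p)
  case 0
  then show ?case using bigO_const[of 0] by (simp add: poly_0[abs_def])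
next
  case (pCons c p)
  have "bigO 0 (\<lambda>t. c + t * poly p t)"
    using bigO_add[OF bigO_const bigO_mono[OF bigO_mult[OF bigO_ident pCons(2)]]] by simp
  then show ?case by simp
qed

text \<open>Nontriviality yields an element with absolute value strictly between 0 and 1, possibly
  after inversion; its powers become arbitrarily small.\<close>

lemma ex_small:
  assumes "0 < r"
  obtains t where "t \<noteq> 0" and "av t \<le> r"
proof -
  obtain x where x: "av x \<noteq> 0" "av x \<noteq> 1"
    using nonarch unfolding nonarch_abs_def by auto
  obtain y where y: "y \<noteq> 0" "av y < 1"
  proof (cases "av x < 1")
    case False
    have "av x * av (inverse x) = 1"
      using x av_mult[of x "inverse x"] by simp
    then have "av (inverse x) = 1 / av x"
      using x by (simp add: field_simps)
    then have "av (inverse x) < 1"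
      using x False by simp
    with x show ?thesis
      by (intro that[of "inverse x"]) auto
  qed (use x that in auto)
  obtain n where "av y ^ n < r"
    using real_arch_pow_inv[OF assms y(2)] by blast
  with y that[of "y ^ n"] show ?thesis
    by (simp add: av_power)
qed

text \<open>Write p = c + t q. Since p and t q are O(t), so is the constant c, which forces c = 0;
  cancelling t leaves the same claim for q with order \<open>m\<close> reduced by one.\<close>

lemma bigO_poly_coeff:
  assumes "bigO m (poly p)" and "j < m"
  shows "coeff p j = 0"
  using assms
proof (induction m arbitrary: p j)
  case (Suc m)
  obtain c q where p: "p = pCons c q" by (rule pCons_cases)
  have "bigO 1 (poly p)"
    using Suc.prems(1) by (rule bigO_mono) simp
  moreover have "bigO 1 (\<lambda>t. - (t * poly q t))"
    using bigO_uminus[OF bigO_mult[OF bigO_ident bigO_poly[of q]]] by simp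
  ultimately have "bigO 1 (\<lambda>t. c)"
    using bigO_add[of 1 "poly p" "\<lambda>t. - (t * poly q t)"] unfolding p by simp
  then obtain r C where r: "0 < r" "0 \<le> C" "\<And>t. t \<noteq> 0 \<Longrightarrow> av t \<le> r \<Longrightarrow> av c \<le> C * av t ^ 1"
    by (rule bigOE) blast
  have c: "c = 0"
  proof (rule ccontr)
    assume "c \<noteq> 0"
    \<comment> \<open>For such small t the bound |c| \<le> C |t| would give |c| < |c|.\<close>
    then have "0 < min r (av c / (C + 1) / 2)"
      using r by simp
    then obtain t where t: "t \<noteq> 0" "av t \<le> min r (av c / (C + 1) / 2)"
      using ex_small by blast
    have "av c \<le> C * (av c / (C + 1) / 2)"
      using r(3)[of t] t mult_left_mono[of "av t" "av c / (C + 1) / 2" C] r(2) by simp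
    moreover have "C * (av c / (C + 1) / 2) < av c"
      using \<open>c \<noteq> 0\<close> r(2) by (simp add: field_simps add_nonneg_pos)
    ultimately show False by simp
  qed
  obtain r C where r: "0 < r" "0 \<le> C"
      "\<And>t. t \<noteq> 0 \<Longrightarrow> av t \<le> r \<Longrightarrow> av (poly p t) \<le> C * av t ^ Suc m"
    using Suc.prems(1) by (rule bigOE) blast
  have "bigO m (poly q)"
  proof (rule bigOI)
    fix t assume "t \<noteq> 0" "av t \<le> r"
    with r(3)[of t] show "av (poly q t) \<le> C * av t ^ m"
      unfolding p c by (simp add: av_mult ac_simps)
  qed (rule r)
  with Suc.IH[of q] Suc.prems(2) show ?case
    unfolding p c by (cases j) auto
qed simp

text \<open>The coefficients of \<open>p\<close> from degree \<open>m\<close> on are left free, so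
  sums and products of approximating polynomials need no truncation.\<close>

definition expands :: "nat \<Rightarrow> ('a \<Rightarrow> 'a) \<Rightarrow> 'a fps \<Rightarrow> bool" where
  "expands m \<phi> A \<longleftrightarrow> (\<exists>p. (\<forall>j<m. coeff p j = A $ j) \<and> bigO m (\<lambda>t. \<phi> t - poly p t))"

lemma expandsI:
  assumes "\<And>j. j < m \<Longrightarrow> coeff p j = A $ j" and "bigO m (\<lambda>t. \<phi> t - poly p t)"
  shows "expands m \<phi> A"
  using assms unfolding expands_def by blast

lemma expandsE:
  assumes "expands m \<phi> A"
  obtains p where "\<And>j. j < m \<Longrightarrow> coeff p j = A $ j" and "bigO m (\<lambda>t. \<phi> t - poly p t)"
  using assms unfolding expands_def by blast

text \<open>The difference of the two approximating polynomials is O(t^m). This turns identities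
  between functions near zero into identities between formal series.\<close>

lemma expands_unique:
  assumes "expands m \<phi> A" and "expands m \<phi> B" and "j < m"
  shows "A $ j = B $ j"
proof -
  obtain p where p: "\<And>j. j < m \<Longrightarrow> coeff p j = A $ j" "bigO m (\<lambda>t. \<phi> t - poly p t)"
    using assms(1) by (rule expandsE) blast
  obtain q where q: "\<And>j. j < m \<Longrightarrow> coeff q j = B $ j" "bigO m (\<lambda>t. \<phi> t - poly q t)"
    using assms(2) by (rule expandsE) blast
  have "poly (q - p) = (\<lambda>t. (\<phi> t - poly p t) + - (\<phi> t - poly q t))"
    by (rule ext) simp
  then have "bigO m (poly (q - p))"
    using bigO_add[OF p(2) bigO_uminus[OF q(2)]] by simp
  then have "coeff (q - p) j = 0"
    using assms(3) by (rule bigO_poly_coeff)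
  with p(1)[OF assms(3)] q(1)[OF assms(3)] show ?thesis by simp
qed

lemma expands_bigO:
  assumes "expands m \<phi> A" and "bigO m (\<lambda>t. \<psi> t - \<phi> t)" and "\<And>j. j < m \<Longrightarrow> A $ j = B $ j"
  shows "expands m \<psi> B"
proof -
  obtain p where p: "\<And>j. j < m \<Longrightarrow> coeff p j = A $ j" "bigO m (\<lambda>t. \<phi> t - poly p t)"
    using assms(1) by (rule expandsE) blast
  show ?thesis
    using p(1) assms(3) bigO_add[OF assms(2) p(2)] by (intro expandsI[of m p]) auto
qed

lemma expands_const: "expands m (\<lambda>t. c) (fps_const c)"
proof (rule expandsI)
  show "coeff [:c:] j = fps_const c $ j" for j
    by (cases j) auto
  show "bigO m (\<lambda>t. c - poly [:c:] t)"
    by (rule bigOI[of 1 _ 0]) auto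
qed

lemma expands_ident: "expands m (\<lambda>t. t) fps_X"
proof (rule expandsI)
  show "coeff [:0, 1:] j = fps_X $ j" for j
    by (cases j; cases "j - 1") auto
  show "bigO m (\<lambda>t. t - poly [:0, 1:] t)"
    by (rule bigOI[of 1 _ 0]) auto
qed

lemma expands_add:
  assumes "expands m \<phi> A" and "expands m \<psi> B"
  shows "expands m (\<lambda>t. \<phi> t + \<psi> t) (A + B)"
proof -
  obtain p where p: "\<And>j. j < m \<Longrightarrow> coeff p j = A $ j" "bigO m (\<lambda>t. \<phi> t - poly p t)"
    using assms(1) by (rule expandsE) blast
  obtain q where q: "\<And>j. j < m \<Longrightarrow> coeff q j = B $ j" "bigO m (\<lambda>t. \<psi> t - poly q t)"
    using assms(2) by (rule expandsE) blast
  show ?thesis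
    using p(1) q(1) bigO_add[OF p(2) q(2)]
    by (intro expandsI[of m "p + q"]) (auto simp: algebra_simps)
qed

lemma expands_mult:
  assumes "expands m \<phi> A" and "expands m \<psi> B"
  shows "expands m (\<lambda>t. \<phi> t * \<psi> t) (A * B)"
proof -
  obtain p where p: "\<And>j. j < m \<Longrightarrow> coeff p j = A $ j" "bigO m (\<lambda>t. \<phi> t - poly p t)"
    using assms(1) by (rule expandsE) blast
  obtain q where q: "\<And>j. j < m \<Longrightarrow> coeff q j = B $ j" "bigO m (\<lambda>t. \<psi> t - poly q t)"
    using assms(2) by (rule expandsE) blast
  \<comment> \<open>Boundedness of \<open>\<psi>\<close> near zero, for the splitting
    \<open>\<phi> \<psi>\<close> - p q = (\<open>\<phi>\<close> - p) \<open>\<psi>\<close> + p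
    (\<open>\<psi>\<close> - q).\<close>
  have "bigO 0 (\<lambda>t. (\<psi> t - poly q t) + poly q t)"
    by (intro bigO_add bigO_mono[OF q(2)] bigO_poly) simp
  then have "bigO m (\<lambda>t. (\<phi> t - poly p t) * \<psi> t)"
    using bigO_mult[OF p(2)] by fastforce
  moreover have "bigO m (\<lambda>t. poly p t * (\<psi> t - poly q t))"
    using bigO_mult[OF bigO_poly q(2)] by simp
  ultimately have "bigO m (\<lambda>t. \<phi> t * \<psi> t - poly (p * q) t)"
    by (auto dest: bigO_add simp: algebra_simps)
  moreover have "coeff (p * q) j = (A * B) $ j" if "j < m" for j
    unfolding coeff_mult fps_mult_nth using that p(1) q(1)
    by (intro sum.cong) auto
  ultimately show ?thesis
    by (intro expandsI)
qed

lemma expands_power: "expands m \<phi> A \<Longrightarrow> expands m (\<lambda>t. \<phi> t ^ n) (A ^ n)"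
  using expands_const[of m 1] by (induction n) (auto intro: expands_mult)

lemma expands_sum:
  "(\<And>i. i \<in> I \<Longrightarrow> expands m (\<phi> i) (A i)) \<Longrightarrow> expands m (\<lambda>t. \<Sum>i\<in>I. \<phi> i t) (\<Sum>i\<in>I. A i)"
  using expands_const[of m 0]
  by (induction I rule: infinite_finite_induct) (auto intro: expands_add)

lemma expands_bigO_1:
  assumes "expands 1 \<phi> A" and "A $ 0 = 0"
  shows "bigO 1 \<phi>"
proof -
  obtain p where p: "\<And>j. j < 1 \<Longrightarrow> coeff p j = A $ j" "bigO 1 (\<lambda>t. \<phi> t - poly p t)"
    using assms(1) by (rule expandsE) blast
  obtain c q where pq: "p = pCons c q" by (rule pCons_cases)
  with p(1)[of 0] assms(2) have "c = 0" by simp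
  then have "poly p = (\<lambda>t. t * poly q t)"
    unfolding pq by (intro ext) simp
  then have "bigO 1 (poly p)"
    using bigO_mult[OF bigO_ident bigO_poly[of q]] by simp
  from bigO_add[OF p(2) this] show ?thesis by simp
qed

text \<open>Each term of index k \<ge> m is at most V (|y| / \<open>\<rho>\<close>)^m because |y|
  \<le> \<open>\<rho>\<close>. The ultrametric inequality bounds the whole tail by the same value,
  with no geometric series to sum.\<close>

lemma series_tail:
  assumes "conv (\<lambda>n. \<Sum>k<n. c k * y ^ k) S" and "\<And>k. av (c k) * \<rho> ^ k \<le> V"
    and "0 < \<rho>" and "av y \<le> \<rho>"
  shows "av (S - (\<Sum>k<m. c k * y ^ k)) \<le> V / \<rho> ^ m * av y ^ m"
proof (rule conv_av_le[OF conv_diff[OF assms(1) conv_const]])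
  have V: "0 \<le> V"
    using assms(2)[of 0] av_nonneg[of "c 0"] by (simp del: av_nonneg)
  have "av ((\<Sum>k<n. c k * y ^ k) - (\<Sum>k<m. c k * y ^ k)) \<le> V / \<rho> ^ m * av y ^ m"
    if "m \<le> n" for n
  proof -
    have "(\<Sum>k<n. c k * y ^ k) - (\<Sum>k<m. c k * y ^ k) = (\<Sum>k=m..<n. c k * y ^ k)"
      using sum_diff_nat_ivl[of 0 m n "\<lambda>k. c k * y ^ k"] that by (simp add: atLeast0LessThan)
    also have "av \<dots> \<le> V / \<rho> ^ m * av y ^ m"
    proof (rule av_sum_le)
      fix k assume k: "k \<in> {m..<n}"
      have "av (c k * y ^ k) = (av (c k) * \<rho> ^ k) * (av y / \<rho>) ^ k"
        using assms(3) by (simp add: av_mult av_power power_divide)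
      also have "\<dots> \<le> V * (av y / \<rho>) ^ m"
        using k V assms by (intro mult_mono power_decreasing) auto
      finally show "av (c k * y ^ k) \<le> V / \<rho> ^ m * av y ^ m"
        by (simp add: power_divide)
    qed (use V assms(3) in simp)
    finally show ?thesis .
  qed
  then show "\<forall>\<^sub>F n in sequentially.
      av ((\<Sum>k<n. c k * y ^ k) - (\<Sum>k<m. c k * y ^ k)) \<le> V / \<rho> ^ m * av y ^ m"
    by (auto simp: eventually_sequentially)
qed

text \<open>Analytic composition agrees with formal composition. As \<open>F\<close> has no constant
  term, \<open>w\<close> is O(t), so the terms \<open>k\<close> \<ge> \<open>m\<close> contribute
  O(t^m); likewise F^k has no coefficient below \<open>k\<close>. The case \<open>F = fps_X\<close>
  expands a single power series.\<close>

lemma expands_series: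
  assumes w: "\<And>m. expands m w F" and F: "F $ 0 = 0"
    and c: "\<And>k. av (c k) * \<rho> ^ k \<le> V" "0 < \<rho>"
    and \<psi>: "\<And>t. av t \<le> r \<Longrightarrow> conv (\<lambda>n. \<Sum>k<n. c k * w t ^ k) (\<psi> t)" "0 < r"
  shows "expands m \<psi> (Abs_fps c oo F)"
proof (rule expands_bigO)
  show "expands m (\<lambda>t. \<Sum>k<m. c k * w t ^ k) (\<Sum>k<m. fps_const (c k) * F ^ k)"
    by (intro expands_sum expands_mult expands_const expands_power w)
  obtain q C where q: "0 < q" "0 \<le> C" "\<And>t. t \<noteq> 0 \<Longrightarrow> av t \<le> q \<Longrightarrow> av (w t) \<le> C * av t ^ 1"
    using expands_bigO_1[OF w F] by (rule bigOE) blast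
  have V: "0 \<le> V"
    using c(1)[of 0] av_nonneg[of "c 0"] by (simp del: av_nonneg)
  show "bigO m (\<lambda>t. \<psi> t - (\<Sum>k<m. c k * w t ^ k))"
  proof (rule bigOI)
    \<comment> \<open>The last bound keeps |w t| \<le> C |t| within \<open>\<rho>\<close>; adding 1
      to \<open>C\<close> avoids a zero denominator.\<close>
    show "0 < min r (min q (\<rho> / (C + 1)))"
      using \<psi> q c by simp
    fix t assume t: "t \<noteq> 0" "av t \<le> min r (min q (\<rho> / (C + 1)))"
    have wt: "av (w t) \<le> C * av t"
      using q(3)[of t] t by simp
    have "av t * (C + 1) \<le> \<rho>"
      using t q(2) by (simp add: field_simps)
    then have "av (w t) \<le> \<rho>"
      using wt av_nonneg[of t] by (simp add: algebra_simps del: av_nonneg)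
    then have "av (\<psi> t - (\<Sum>k<m. c k * w t ^ k)) \<le> V / \<rho> ^ m * av (w t) ^ m"
      using t by (intro series_tail \<psi> c) auto
    also have "\<dots> \<le> V / \<rho> ^ m * (C * av t) ^ m"
      using V c(2) wt by (intro mult_left_mono power_mono) auto
    finally show "av (\<psi> t - (\<Sum>k<m. c k * w t ^ k)) \<le> (V / \<rho> ^ m * C ^ m) * av t ^ m"
      by (simp add: power_mult_distrib ac_simps)
  qed
  fix j assume "j < m"
  have "(\<Sum>k<m. c k * (F ^ k) $ j) = (\<Sum>k=0..j. c k * (F ^ k) $ j)"
    using \<open>j < m\<close> startsby_zero_power_prefix[OF F]
    by (intro sum.mono_neutral_right) auto
  then show "(\<Sum>k<m. fps_const (c k) * F ^ k) $ j = (Abs_fps c oo F) $ j"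
    by (simp add: fps_sum_nth fps_compose_nth)
qed

section \<open>Power series on discs\<close>

lemma ps_sums_iff: "ps_sums av c x0 x s \<longleftrightarrow> conv (\<lambda>n. \<Sum>k<n. c k * (x - x0) ^ k) s"
  unfolding ps_sums_def limitin_iff_conv ..

lemma ps_sums_eval: "ps_conv av c x0 x \<Longrightarrow> ps_sums av c x0 x (ps_eval av c x0 x)"
  unfolding ps_conv_def ps_eval_def by (rule theI') (auto simp: ps_sums_iff dest: conv_unique)

lemma tendsto_0_bounded:
  fixes w :: "nat \<Rightarrow> real"
  assumes "w \<longlonglongrightarrow> 0" and "0 < w j"
  obtains V where "0 < V" and "\<And>k. w k \<le> V"
proof (rule last_maximum[OF assms])
  fix N assume N: "\<And>k. w k \<le> w N"
  show thesis
    by (rule that[OF less_le_trans[OF assms(2) N] N])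
qed

text \<open>Partial sums as polynomials: the estimates from \<open>pdom\<close> are applied to these
  and then passed to the limit.\<close>

definition trunc :: "nat \<Rightarrow> (nat \<Rightarrow> 'a) \<Rightarrow> 'a poly" where
  "trunc n c = (\<Sum>k<n. monom (c k) k)"

lemma coeff_trunc: "coeff (trunc n c) k = (if k < n then c k else 0)"
  unfolding trunc_def coeff_sum by (simp add: sum.delta)

lemma poly_trunc: "poly (trunc n c) x = (\<Sum>k<n. c k * x ^ k)"
  unfolding trunc_def poly_sum by (simp add: poly_monom)

lemma pdom_trunc:
  assumes "0 < s" and "\<And>k. N < k \<Longrightarrow> av (c k) * s ^ k < av (c N) * s ^ N" and "N < n"
  shows "pdom (trunc n c) N s"
proof -
  have "0 \<le> av (c (Suc N)) * s ^ Suc N"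
    using assms(1) by simp
  also have "\<dots> < av (c N) * s ^ N"
    by (rule assms) simp
  finally show ?thesis
    using assms unfolding pdom_def coeff_trunc by simp
qed

text \<open>The centre of an ultrametric disc can be moved to \<open>x0\<close>. Hence a point
  \<open>p\<close> of the disc can represent a radius |p - x0|, whatever the shape of the
  disc.\<close>

lemma disc_contains:
  assumes "is_disc av D" "x0 \<in> D" "p \<in> D" "av (x - x0) \<le> av (p - x0)"
  shows "x \<in> D"
proof -
  have bound: "av (x - c) \<le> max (av (p - c)) (av (x0 - c))" for c
    using av_triangle[of x c x0] av_triangle[of p x0 c] assms(4) av_commute[of c x0] by auto
  then have "av (x - c) < r" if "av (p - c) < r" "av (x0 - c) < r" for c r
    using that le_less_trans max_less_iff_conj by blast
  moreover have "av (x - c) \<le> r" if "av (p - c) \<le> r" "av (x0 - c) \<le> r" for c r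
    using that order_trans[OF bound max.boundedI] by blast
  ultimately show ?thesis
    using assms(1-3) unfolding is_disc_def by auto
qed

lemma disc_nontrivial:
  assumes "is_disc av D" "x0 \<in> D"
  obtains p where "p \<in> D" "p \<noteq> x0"
proof (cases "D = UNIV")
  case True
  then show ?thesis
    using that[of "x0 + 1"] by simp
next
  case False
  then obtain c r where r: "0 < r" "D = {x. av (x - c) < r} \<or> D = {x. av (x - c) \<le> r}"
    using assms(1) unfolding is_disc_def by blast
  obtain t where t: "t \<noteq> 0" "av t \<le> r / 2"
    using ex_small[of "r / 2"] r(1) by auto
  have "av (x0 + t - c) \<le> max (av (x0 - c)) (av t)"
    using av_add[of "x0 - c" t] by (simp add: algebra_simps)
  then have "x0 + t \<in> D"
    using r assms(2) t by auto
  with t that show ?thesis by auto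
qed

text \<open>This is |x^k - y^k| \<le> |x - y| s^(k-1), multiplied by \<open>s\<close> to avoid the
  exponent k - 1 at k = 0.\<close>

lemma av_power_diff:
  assumes "av x \<le> s" and "av y \<le> s"
  shows "av (x ^ k - y ^ k) * s \<le> av (x - y) * s ^ k"
proof (induction k)
  case (Suc k)
  have s: "0 \<le> s"
    using assms(1) av_nonneg[of x] by linarith
  have "x ^ Suc k - y ^ Suc k = x * (x ^ k - y ^ k) + (x - y) * y ^ k"
    by (simp add: algebra_simps)
  then have "av (x ^ Suc k - y ^ Suc k) \<le> max (av x * av (x ^ k - y ^ k)) (av (x - y) * av y ^ k)"
    using av_add[of "x * (x ^ k - y ^ k)" "(x - y) * y ^ k"] by (simp add: av_mult av_power)
  then have "av (x ^ Suc k - y ^ Suc k) * s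
      \<le> max (av x * (av (x ^ k - y ^ k) * s)) (av (x - y) * (av y ^ k * s))"
    using mult_right_mono[OF _ s, of "av (x ^ Suc k - y ^ Suc k)"
        "max (av x * av (x ^ k - y ^ k)) (av (x - y) * av y ^ k)"] s
    by (simp add: max_mult_distrib_right mult.assoc del: power_Suc)
  also have "\<dots> \<le> av (x - y) * s ^ Suc k"
  proof (rule max.boundedI)
    have "av x * (av (x ^ k - y ^ k) * s) \<le> s * (av (x - y) * s ^ k)"
      by (rule mult_mono[OF assms(1) Suc.IH]) (use s in auto)
    then show "av x * (av (x ^ k - y ^ k) * s) \<le> av (x - y) * s ^ Suc k"
      by (simp add: ac_simps)
    have "av (x - y) * (av y ^ k * s) \<le> av (x - y) * (s ^ k * s)"
      using assms s by (intro mult_left_mono mult_right_mono power_mono) auto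
    then show "av (x - y) * (av y ^ k * s) \<le> av (x - y) * s ^ Suc k"
      by (simp add: ac_simps)
  qed
  finally show ?case .
qed simp

end

section \<open>Linearization discs\<close>

locale linearized = nonarch_field av
  for av :: "'a::field \<Rightarrow> real" +
  fixes a b :: "nat \<Rightarrow> 'a" and x0 lam :: 'a and D :: "'a set"
  assumes complete: "mcomplete"
    and a_0: "a 0 = x0" and a_1: "av (a 1) = 1" and lam: "av lam = 1"
    and b_0: "b 0 = 0" and b_1: "b 1 \<noteq> 0"
    and disc: "is_disc av D" and x0_in: "x0 \<in> D" and lin: "lin_prop av a b x0 lam D"
begin

abbreviation "f \<equiv> ps_eval av a x0"
abbreviation "g \<equiv> ps_eval av b x0"

lemma f_conv: "x \<in> D \<Longrightarrow> conv (\<lambda>n. \<Sum>k<n. a k * (x - x0) ^ k) (f x)"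
  and g_conv: "x \<in> D \<Longrightarrow> conv (\<lambda>n. \<Sum>k<n. b k * (x - x0) ^ k) (g x)"
  and g_conv_f: "x \<in> D \<Longrightarrow> conv (\<lambda>n. \<Sum>k<n. b k * (f x - x0) ^ k) (g (f x))"
  using lin ps_sums_eval unfolding lin_prop_def ps_sums_iff by blast+

lemma g_f: "x \<in> D \<Longrightarrow> g (f x) = lam * g x"
  and g_inj: "inj_on g D"
  using lin unfolding lin_prop_def by auto

lemma in_disc: "p \<in> D \<Longrightarrow> av (x - x0) \<le> av (p - x0) \<Longrightarrow> x \<in> D"
  using disc_contains[OF disc x0_in] .

lemma coeff_tendsto_0:
  assumes "p \<in> D"
  shows "(\<lambda>k. av (a k) * av (p - x0) ^ k) \<longlonglongrightarrow> 0"
    and "(\<lambda>k. av (b k) * av (p - x0) ^ k) \<longlonglongrightarrow> 0"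
  using conv_terms[OF f_conv[OF assms]] conv_terms[OF g_conv[OF assms]]
  by (simp_all add: av_mult av_power)

lemma f_x0: "f x0 = x0"
proof (rule conv_unique[OF f_conv[OF x0_in]])
  have "(\<Sum>k<n. a k * (x0 - x0) ^ k) = x0" if "1 \<le> n" for n
    using that a_0 by (cases n) (auto simp: sum.lessThan_Suc_shift simp del: sum.lessThan_Suc)
  then show "conv (\<lambda>n. \<Sum>k<n. a k * (x0 - x0) ^ k) x0"
    by (intro conv_cong[OF conv_const[of x0]]) (auto simp: eventually_sequentially)
qed

text \<open>The series of t \<mapsto> f(x0 + t) - x0, that is \<open>f\<close> recentred at its
  fixed point; its zero constant term is what formal composition requires.\<close>

definition F :: "'a fps" where "F = Abs_fps (\<lambda>k. if k = 0 then 0 else a k)"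

text \<open>Both sides are expansions to every order of the function t \<mapsto> g(f(x0 + t)) near
  zero, so they agree by uniqueness of expansions.\<close>

lemma formal_semiconj: "Abs_fps b oo F = fps_const lam * Abs_fps b"
proof (rule fps_ext)
  fix n
  obtain p where p: "p \<in> D" "p \<noteq> x0"
    using disc_nontrivial[OF disc x0_in] .
  define \<rho> where "\<rho> = av (p - x0)"
  have \<rho>: "0 < \<rho>"
    using p unfolding \<rho>_def by simp
  have D: "x0 + t \<in> D" if "av t \<le> \<rho>" for t
    using in_disc[OF p(1), of "x0 + t"] that unfolding \<rho>_def by simp
  note lim = coeff_tendsto_0[OF p(1), folded \<rho>_def]
  obtain V where V: "\<And>k. av (a k) * \<rho> ^ k \<le> V"
    using tendsto_0_bounded[OF lim(1), of 1] \<rho> a_1 by auto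
  obtain W where W: "\<And>k. av (b k) * \<rho> ^ k \<le> W"
    using tendsto_0_bounded[OF lim(2), of 1] \<rho> b_1 by auto
  define w where "w t = f (x0 + t) - x0" for t
  have w_conv: "conv (\<lambda>n. \<Sum>k<n. (if k = 0 then 0 else a k) * t ^ k) (w t)" if "av t \<le> \<rho>" for t
  proof -
    have *: "(\<Sum>k<n. a k * t ^ k) - x0 = (\<Sum>k<n. (if k = 0 then 0 else a k) * t ^ k)" if "1 \<le> n" for n
      using that a_0 by (cases n) (auto simp: sum.lessThan_Suc_shift simp del: sum.lessThan_Suc)
    have "conv (\<lambda>n. (\<Sum>k<n. a k * t ^ k) - x0) (w t)"
      using conv_diff[OF f_conv[OF D[OF that]] conv_const[of x0]] unfolding w_def by simp
    then show ?thesis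
      by (rule conv_cong) (use * in \<open>auto simp: eventually_sequentially\<close>)
  qed
  have "0 \<le> V"
    using V[of 0] av_nonneg[of "a 0"] by (simp del: av_nonneg)
  have w: "expands m w F" for m
  proof -
    have "expands m w (Abs_fps (\<lambda>k. if k = 0 then 0 else a k) oo fps_X)"
      by (rule expands_series[OF expands_ident _ _ \<rho> w_conv \<rho>]) (use V \<open>0 \<le> V\<close> in auto)
    then show ?thesis
      by (simp add: F_def)
  qed
  have g1: "expands (Suc n) (\<lambda>t. g (f (x0 + t))) (Abs_fps b oo F)"
    by (rule expands_series[OF w _ W \<rho> _ \<rho>])
      (use g_conv_f D in \<open>auto simp: F_def w_def\<close>)
  have "expands (Suc n) (\<lambda>t. g (x0 + t)) (Abs_fps b oo fps_X)"
    by (rule expands_series[OF expands_ident _ W \<rho> _ \<rho>]) (use g_conv[OF D] in auto)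
  then have "expands (Suc n) (\<lambda>t. lam * g (x0 + t)) (fps_const lam * Abs_fps b)"
    by (intro expands_mult expands_const) simp
  moreover have "bigO (Suc n) (\<lambda>t. g (f (x0 + t)) - lam * g (x0 + t))"
    by (rule bigOI[OF \<rho>, where C = 0]) (use g_f[OF D] in auto)
  ultimately have "expands (Suc n) (\<lambda>t. g (f (x0 + t))) (fps_const lam * Abs_fps b)"
    by (rule expands_bigO) simp
  from expands_unique[OF g1 this] show "(Abs_fps b oo F) $ n = (fps_const lam * Abs_fps b) $ n"
    by simp
qed

text \<open>By \<open>linearizable_coeff_less\<close> the linear coefficient dominates all higher
  ones at radius |p - x0|. The divided difference of a truncation of \<open>f\<close> then has a
  dominant constant term of absolute value |a 1| = 1, and this passes to the limit.\<close>

lemma f_isometry_ball: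
  assumes p: "p \<in> D" and x: "av (x - x0) \<le> av (p - x0)" and y: "av (y - x0) \<le> av (p - x0)"
  shows "av (f x - f y) = av (x - y)"
proof (cases "p = x0")
  case True
  then have "x = x0" "y = x0"
    using x y av_nonneg[of "x - x0"] av_nonneg[of "y - x0"]
    by (auto simp del: av_nonneg)
  then show ?thesis by simp
next
  case False
  define s where "s = av (p - x0)"
  have s: "0 < s"
    using False by (simp add: s_def)
  note lim = coeff_tendsto_0[OF p, folded s_def]
  have limF: "(\<lambda>k. av (F $ k) * s ^ k) \<longlonglongrightarrow> 0"
    using lim(1) by (rule Lim_transform_eventually)
      (auto simp: F_def eventually_sequentially intro!: exI[of _ 1])
  have small: "av (a k) * s ^ k < av (a 1) * s ^ 1" if "1 < k" for k
    using linearizable_coeff_less[OF formal_semiconj lam _ _ _ _ s limF _, of k]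
      lim(2) that a_1 b_0 b_1 by (simp add: F_def)
  have pd: "pdom (trunc n a) (Suc 0) s" if "2 \<le> n" for n
    using that s small by (intro pdom_trunc) auto
  have "av ((\<Sum>k<n. a k * (x - x0) ^ k) - (\<Sum>k<n. a k * (y - x0) ^ k)) = av (x - y)"
    if "2 \<le> n" for n
  proof -
    let ?q = "synthetic_div (trunc n a) (y - x0)"
    have "pdom ?q 0 s" and q: "av (coeff ?q 0) = av (coeff (trunc n a) (Suc 0))"
      using pdom_synthetic_div[OF pd[OF that]] y by (auto simp: s_def)
    then have "av (poly ?q (x - x0)) = 1"
      using av_poly_pdom_0[of ?q s] x that a_1 by (simp add: s_def coeff_trunc)
    then show ?thesis
      using poly_synthetic_div[of "trunc n a" "x - x0" "y - x0"]
      by (simp add: poly_trunc[symmetric] av_mult)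
  qed
  then show ?thesis
    by (intro conv_av_eq[OF conv_diff[OF f_conv f_conv]] in_disc[OF p] x y)
      (auto simp: eventually_sequentially)
qed

lemma f_isometry:
  assumes "x \<in> D" "y \<in> D"
  shows "av (f x - f y) = av (x - y)"
  using f_isometry_ball[of x x y] f_isometry_ball[of y x y] assms
  by (cases "av (x - x0) \<le> av (y - x0)") auto

text \<open>Termwise, |b_k| |x^k - y^k| is controlled by \<open>av_power_diff\<close> and the bound
  on |b_k| s^k. If p = x0, the ball is a single point.\<close>

lemma g_lipschitz:
  assumes p: "p \<in> D"
  obtains C where "0 < C" and "\<And>x y. av (x - x0) \<le> av (p - x0) \<Longrightarrow> av (y - x0) \<le> av (p - x0) \<Longrightarrow>
    av (g x - g y) \<le> C * av (x - y)"
proof (cases "p = x0")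
  case True
  then have eq: "x = x0" if "av (x - x0) \<le> av (p - x0)" for x
    using that av_nonneg[of "x - x0"] by (auto simp del: av_nonneg)
  show ?thesis
  proof (rule that[of 1])
    fix x y assume "av (x - x0) \<le> av (p - x0)" "av (y - x0) \<le> av (p - x0)"
    then have "x = x0" "y = x0"
      by (auto intro: eq)
    then show "av (g x - g y) \<le> 1 * av (x - y)"
      by simp
  qed simp
next
  case False
  define s where "s = av (p - x0)"
  have s: "0 < s"
    using False by (simp add: s_def)
  obtain V where V: "0 < V" "\<And>k. av (b k) * s ^ k \<le> V"
    using tendsto_0_bounded[OF coeff_tendsto_0(2)[OF p, folded s_def], of 1] s b_1 by auto
  show ?thesis
  proof (rule that)
    show "0 < V / s"
      using V s by simp
    fix x y assume x: "av (x - x0) \<le> av (p - x0)" and y: "av (y - x0) \<le> av (p - x0)"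
    have summand: "av (b k * (x - x0) ^ k - b k * (y - x0) ^ k) \<le> V / s * av (x - y)" for k
    proof -
      have "av (b k * (x - x0) ^ k - b k * (y - x0) ^ k) * s
          = av (b k) * (av ((x - x0) ^ k - (y - x0) ^ k) * s)"
        by (simp add: av_mult flip: right_diff_distrib)
      also have "\<dots> \<le> av (b k) * (av (x - y) * s ^ k)"
        using av_power_diff[OF x y, of k] unfolding s_def by (intro mult_left_mono) auto
      also have "\<dots> \<le> V * av (x - y)"
        using mult_right_mono[OF V(2)[of k], of "av (x - y)"] by (simp add: ac_simps)
      finally show ?thesis
        using s by (simp add: field_simps)
    qed
    have "av ((\<Sum>k<n. b k * (x - x0) ^ k) - (\<Sum>k<n. b k * (y - x0) ^ k)) \<le> V / s * av (x - y)" for n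
      unfolding sum_subtractf[symmetric] using V s by (intro av_sum_le summand) auto
    then show "av (g x - g y) \<le> V / s * av (x - y)"
      by (intro conv_av_le[OF conv_diff[OF g_conv g_conv]] in_disc[OF p] x y) auto
  qed
qed

text \<open>\<open>N\<close> is the last maximum of the series of g - v at radius |p - x0|, and
  \<open>C\<close> is the absolute value of that coefficient. They depend on \<open>p\<close> and
  \<open>v\<close> only, so the bound is uniform in \<open>A\<close>, \<open>\<epsilon>\<close> and
  \<open>\<delta>\<close>.\<close>

lemma g_separated:
  assumes p: "p \<in> D" "p \<noteq> x0"
  obtains N C where "0 < C" and "\<And>A \<epsilon> \<delta>. card A = Suc N \<Longrightarrow> 0 < \<epsilon> \<Longrightarrow>
    (\<And>x. x \<in> A \<Longrightarrow> av (x - x0) \<le> av (p - x0)) \<Longrightarrow>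
    (\<And>x y. x \<in> A \<Longrightarrow> y \<in> A \<Longrightarrow> x \<noteq> y \<Longrightarrow> \<epsilon> \<le> av (x - y)) \<Longrightarrow>
    (\<And>x. x \<in> A \<Longrightarrow> av (g x - v) \<le> \<delta>) \<Longrightarrow> C * \<epsilon> ^ N \<le> \<delta>"
proof -
  define s where "s = av (p - x0)"
  have s: "0 < s"
    using p by (simp add: s_def)
  \<comment> \<open>The coefficients of g - v; the constant term is -v because \<open>b 0\<close> =
    0.\<close>
  define c where "c k = (if k = 0 then - v else b k)" for k
  have "(\<lambda>k. av (c k) * s ^ k) \<longlonglongrightarrow> 0"
    using coeff_tendsto_0(2)[OF p(1), folded s_def] by (rule Lim_transform_eventually)
      (auto simp: c_def eventually_sequentially intro!: exI[of _ 1])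
  moreover have "0 < av (c 1) * s ^ 1"
    using s b_1 by (simp add: c_def)
  ultimately obtain N where N: "\<And>k. av (c k) * s ^ k \<le> av (c N) * s ^ N"
      "\<And>k. N < k \<Longrightarrow> av (c k) * s ^ k < av (c N) * s ^ N"
    using last_maximum[of "\<lambda>k. av (c k) * s ^ k" 1] by auto
  have "c N \<noteq> 0"
    using N(1)[of 1] \<open>0 < av (c 1) * s ^ 1\<close> by auto
  show ?thesis
  proof (rule that)
    show "0 < av (c N)"
      using \<open>c N \<noteq> 0\<close> by simp
    fix A \<epsilon> \<delta>
    assume A: "card A = Suc N" and \<epsilon>: "(0::real) < \<epsilon>"
      and ball: "\<And>x. x \<in> A \<Longrightarrow> av (x - x0) \<le> av (p - x0)"
      and sep: "\<And>x y. x \<in> A \<Longrightarrow> y \<in> A \<Longrightarrow> x \<noteq> y \<Longrightarrow> \<epsilon> \<le> av (x - y)"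
      and gA: "\<And>x. x \<in> A \<Longrightarrow> av (g x - v) \<le> \<delta>"
    show "av (c N) * \<epsilon> ^ N \<le> \<delta>"
    \<comment> \<open>The truncations only approximate g - v, hence the slack \<open>\<eta>\<close>;
      since \<open>A\<close> is finite, one truncation serves all its points.\<close>
    proof (rule field_le_epsilon)
      fix \<eta> :: real assume \<eta>: "0 < \<eta>"
      have fin: "finite A"
        using A by (simp add: card_ge_0_finite)
      have ev: "eventually (\<lambda>n. av (poly (trunc n c) (x - x0)) < \<delta> + \<eta>) sequentially" if "x \<in> A" for x
      proof -
        have *: "(\<Sum>k<n. b k * (x - x0) ^ k) - v = poly (trunc n c) (x - x0)" if "1 \<le> n" for n
          unfolding poly_trunc c_def using that b_0
          by (cases n) (auto simp: sum.lessThan_Suc_shift simp del: sum.lessThan_Suc)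
        have "conv (\<lambda>n. (\<Sum>k<n. b k * (x - x0) ^ k) - v) (g x - v)"
          using in_disc[OF p(1) ball[OF that]] by (intro conv_diff conv_const g_conv)
        then have "conv (\<lambda>n. poly (trunc n c) (x - x0)) (g x - v)"
          by (rule conv_cong) (use * in \<open>auto simp: eventually_sequentially\<close>)
        from conv_av[OF this] show ?thesis
          using gA[OF that] \<eta> by (intro order_tendstoD(2)) auto
      qed
      then have "eventually (\<lambda>n. \<forall>x\<in>A. av (poly (trunc n c) (x - x0)) < \<delta> + \<eta>) sequentially"
        using fin by (intro eventually_ball_finite) auto
      then have "eventually (\<lambda>n. (\<forall>x\<in>A. av (poly (trunc n c) (x - x0)) < \<delta> + \<eta>) \<and> N < n) sequentially"
        using eventually_gt_at_top[of N] by (rule eventually_conj)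
      then obtain n where n: "\<And>x. x \<in> A \<Longrightarrow> av (poly (trunc n c) (x - x0)) < \<delta> + \<eta>" "N < n"
        using eventually_happens'[OF sequentially_bot] by blast
      have "av (coeff (trunc n c) N) * \<epsilon> ^ N \<le> \<delta> + \<eta>"
      proof (rule pdom_separated)
        show "pdom (trunc n c) N s"
          using s N n by (intro pdom_trunc) auto
        show "card ((\<lambda>x. x - x0) ` A) = Suc N"
          using A by (subst card_image) (auto simp: inj_on_def)
      qed (use ball sep n \<epsilon> in \<open>auto simp: s_def intro: less_imp_le\<close>)
      then show "av (c N) * \<epsilon> ^ N \<le> \<delta> + \<eta>"
        using n by (simp add: coeff_trunc)
    qed
  qed
qed

end

section \<open>Orbits\<close>

lemma funpow_mult_left: "((\<lambda>z. c * z) ^^ n) z = c ^ n * (z :: 'a :: comm_monoid_mult)"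
  by (induction n) (auto simp: mult.assoc)

locale linearized_orbits = linearized av a b x0 lam D
  for av :: "'a::field \<Rightarrow> real" and a b :: "nat \<Rightarrow> 'a" and x0 lam :: 'a and D :: "'a set" +
  fixes X :: "'a set"
  assumes X_subset: "X \<subseteq> D" and f_X: "f ` X \<subseteq> X"
begin

lemma orbit_in: "y \<in> X \<Longrightarrow> (f ^^ n) y \<in> X"
  using f_X by (induction n) auto

lemma orbit_in_D: "y \<in> X \<Longrightarrow> (f ^^ n) y \<in> D"
  using orbit_in X_subset by blast

lemma orbit_isometry:
  assumes "u \<in> X" "v \<in> X"
  shows "av ((f ^^ n) u - (f ^^ n) v) = av (u - v)"
  using assms by (induction n) (auto simp: f_isometry orbit_in_D)

lemma orbit_sphere:
  assumes "y \<in> X"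
  shows "av ((f ^^ n) y - x0) = av (y - x0)"
proof (induction n)
  case (Suc n)
  then show ?case
    using f_isometry[OF orbit_in_D[OF assms, of n] x0_in] by (simp add: f_x0)
qed simp

lemma g_orbit: "y \<in> X \<Longrightarrow> g ((f ^^ n) y) = lam ^ n * g y"
  by (induction n) (auto simp: g_f orbit_in_D)

section \<open>Transfer of dense orbits between \<open>X\<close> and its image under
  \<open>g\<close>\<close>

lemma transitive_image:
  assumes "transitive_on av f X"
  shows "transitive_on av (\<lambda>z. lam * z) (g ` X)"
proof -
  obtain y where y: "y \<in> X" and dense: "X \<subseteq> ktop av closure_of {(f ^^ n) y |n. True}"
    using assms unfolding transitive_on_def by blast
  have "\<exists>n. av (lam ^ n * g y - g u) < \<epsilon>" if u: "u \<in> X" and \<epsilon>: "0 < \<epsilon>" for u \<epsilon>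
  proof -
    \<comment> \<open>The farther of the two points: the ball through it contains \<open>u\<close>
      and the orbit of \<open>y\<close>, which stays on a sphere around \<open>x0\<close>.\<close>
    define p where "p = (if av (u - x0) \<le> av (y - x0) then y else u)"
    have p: "p \<in> D" "av (u - x0) \<le> av (p - x0)" "av (y - x0) \<le> av (p - x0)"
      using u y X_subset by (auto simp: p_def)
    obtain C where C: "0 < C" and lip: "\<And>x x'. av (x - x0) \<le> av (p - x0) \<Longrightarrow>
        av (x' - x0) \<le> av (p - x0) \<Longrightarrow> av (g x - g x') \<le> C * av (x - x')"
      using g_lipschitz[OF p(1)] by blast
    have "u \<in> ktop av closure_of {(f ^^ n) y |n. True}"
      using dense u by blast
    moreover have "0 < \<epsilon> / C"
      using C \<epsilon> by simp
    ultimately obtain n where n: "av ((f ^^ n) y - u) < \<epsilon> / C"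
      unfolding mem_closure_iff by blast
    have "av (lam ^ n * g y - g u) \<le> C * av ((f ^^ n) y - u)"
      using lip[of "(f ^^ n) y" u] p by (simp add: orbit_sphere[OF y] g_orbit[OF y])
    also have "\<dots> < \<epsilon>"
      using n C by (simp add: field_simps)
    finally show ?thesis by blast
  qed
  then show ?thesis
    unfolding transitive_on_def mem_closure_iff subset_iff funpow_mult_left using y by blast
qed

lemma transitive_on_iff:
  "transitive_on av f X \<longleftrightarrow> (\<exists>y\<in>X. \<forall>u\<in>X. \<forall>\<epsilon>>0. \<exists>n. av ((f ^^ n) y - u) < \<epsilon>)"
  unfolding transitive_on_def mem_closure_iff subset_iff by blast

text \<open>If f^m moves \<open>y\<close> by less than \<open>\<epsilon>\<close>, then by isometry
  it moves every orbit point by less than \<open>\<epsilon>\<close>. Subtracting \<open>m\<close>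
  from the index repeatedly reaches one of the first \<open>m\<close> points, and ultrametric errors
  do not add up.\<close>

lemma orbit_totally_bounded:
  assumes y: "y \<in> X" and rec: "\<And>\<epsilon>. 0 < \<epsilon> \<Longrightarrow> \<exists>m>0. av ((f ^^ m) y - y) < \<epsilon>"
  shows "mtotally_bounded (range (\<lambda>n. (f ^^ n) y))"
  unfolding mtotally_bounded_def
proof (intro allI impI)
  fix \<epsilon> :: real assume "0 < \<epsilon>"
  then obtain m where m: "0 < m" "av ((f ^^ m) y - y) < \<epsilon>"
    using rec by blast
  have near: "\<exists>k<m. av ((f ^^ n) y - (f ^^ k) y) < \<epsilon>" for n
  proof (induction n rule: less_induct)
    case (less n)
    show ?case
    proof (cases "n < m")
      case True
      with \<open>0 < \<epsilon>\<close> show ?thesis by (intro exI[of _ n]) simp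
    next
      case False
      then obtain k where k: "k < m" "av ((f ^^ (n - m)) y - (f ^^ k) y) < \<epsilon>"
        using less[of "n - m"] m by auto
      have "(f ^^ n) y = (f ^^ (n - m)) ((f ^^ m) y)"
        using False funpow_add[of "n - m" m f] by simp
      then have "av ((f ^^ n) y - (f ^^ (n - m)) y) < \<epsilon>"
        using orbit_isometry[OF orbit_in[OF y, of m] y, of "n - m"] m by simp
      with k av_triangle[of "(f ^^ n) y" "(f ^^ k) y" "(f ^^ (n - m)) y"] show ?thesis
        by (intro exI[of _ k]) auto
    qed
  qed
  show "\<exists>K. finite K \<and> K \<subseteq> range (\<lambda>n. (f ^^ n) y) \<and> range (\<lambda>n. (f ^^ n) y) \<subseteq> (\<Union>x\<in>K. mball x \<epsilon>)"
  proof (intro exI[of _ "(\<lambda>k. (f ^^ k) y) ` {..<m}"] conjI)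
    show "range (\<lambda>n. (f ^^ n) y) \<subseteq> (\<Union>x\<in>(\<lambda>k. (f ^^ k) y) ` {..<m}. mball x \<epsilon>)"
      using near by (fastforce simp: kdist_def av_commute)
  qed auto
qed

lemma orbit_dense_lift:
  assumes y: "y \<in> X" and u: "u \<in> X" and dense: "\<And>\<epsilon>. 0 < \<epsilon> \<Longrightarrow> \<exists>n. av (lam ^ n * g y - g u) < \<epsilon>"
    and "0 < \<epsilon>"
  shows "\<exists>n. av ((f ^^ n) y - u) < \<epsilon>"
proof (cases "\<exists>n. lam ^ n * g y = g u")
  case True
  then obtain n where "g ((f ^^ n) y) = g u"
    using g_orbit[OF y] by metis
  then have "(f ^^ n) y = u"
    using inj_onD[OF g_inj] orbit_in_D[OF y] u X_subset by blast
  with \<open>0 < \<epsilon>\<close> show ?thesis by (intro exI[of _ n]) simp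
next
  case False
  let ?S = "\<lambda>\<delta>. {n. av (lam ^ n * g y - g u) < \<delta>}"
  \<comment> \<open>As g(u) is not on the orbit, all distances are positive; finitely many of them
    would have a positive minimum, contradicting density.\<close>
  have inf: "infinite (?S \<delta>)" if "0 < \<delta>" for \<delta>
  proof
    assume fin: "finite (?S \<delta>)"
    let ?M = "Min (insert \<delta> ((\<lambda>n. av (lam ^ n * g y - g u)) ` ?S \<delta>))"
    have "0 < ?M"
      using fin that False by (subst Min_gr_iff) auto
    then obtain n where n: "av (lam ^ n * g y - g u) < ?M"
      using dense by blast
    moreover have "?M \<le> \<delta>"
      using fin by (intro Min_le) auto
    ultimately have "n \<in> ?S \<delta>" by auto
    then have "?M \<le> av (lam ^ n * g y - g u)"
      using fin by (intro Min_le) auto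
    with n show False by simp
  qed
  have yD: "y \<in> D"
    using y X_subset by blast
  \<comment> \<open>The orbit of the fixed point is constant, so it could only be dense near g(u) by
    hitting it.\<close>
  have "y \<noteq> x0"
  proof
    assume "y = x0"
    then have "(f ^^ n) y = y" for n
      using f_x0 by (induction n) auto
    then have const: "lam ^ n * g y = g y" for n
      using g_orbit[OF y, of n] by (simp del: mult_cancel_right1 mult_cancel_right2)
    then have "?S (av (g y - g u)) = {}"
      by (simp only: const) simp
    moreover have "0 < av (g y - g u)"
      using False by (force simp: const)
    ultimately show False
      using inf[of "av (g y - g u)"] by simp
  qed
  \<comment> \<open>Without recurrence the isometry makes all orbit points
    \<open>\<eta>\<close>-separated, while infinitely many of them have g-values close to g(u); this
    contradicts \<open>g_separated\<close>.\<close>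
  have rec: "\<exists>m>0. av ((f ^^ m) y - y) < \<eta>" if \<eta>: "0 < \<eta>" for \<eta>
  proof (rule ccontr)
    assume "\<not> (\<exists>m>0. av ((f ^^ m) y - y) < \<eta>)"
    then have far: "\<eta> \<le> av ((f ^^ m) y - y)" if "0 < m" for m
      using that not_le by blast
    have sep_less: "\<eta> \<le> av ((f ^^ n) y - (f ^^ m) y)" if "m < n" for m n
    proof -
      have "(f ^^ n) y = (f ^^ m) ((f ^^ (n - m)) y)"
        using that funpow_add[of m "n - m" f] by simp
      then show ?thesis
        using orbit_isometry[OF orbit_in[OF y, of "n - m"] y, of m] far[of "n - m"] that by simp
    qed
    have sep: "\<eta> \<le> av ((f ^^ n) y - (f ^^ m) y)" if "m \<noteq> n" for m n
    proof (cases "m < n")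
      case False
      with that have "\<eta> \<le> av ((f ^^ m) y - (f ^^ n) y)"
        by (intro sep_less) simp
      then show ?thesis
        by (subst av_commute)
    qed (rule sep_less)
    then have inj: "inj (\<lambda>n. (f ^^ n) y)"
      using \<eta> by (intro injI) (metis diff_self av_0 not_le)
    show False
    proof (rule g_separated[OF yD \<open>y \<noteq> x0\<close>, of "g u"])
      fix N C
      assume C: "0 < C" and bound: "\<And>A \<epsilon> \<delta>. card A = Suc N \<Longrightarrow> 0 < \<epsilon> \<Longrightarrow>
          (\<And>x. x \<in> A \<Longrightarrow> av (x - x0) \<le> av (y - x0)) \<Longrightarrow>
          (\<And>x y. x \<in> A \<Longrightarrow> y \<in> A \<Longrightarrow> x \<noteq> y \<Longrightarrow> \<epsilon> \<le> av (x - y)) \<Longrightarrow>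
          (\<And>x. x \<in> A \<Longrightarrow> av (g x - g u) \<le> \<delta>) \<Longrightarrow> C * \<epsilon> ^ N \<le> \<delta>"
      \<comment> \<open>Half of the lower bound that \<open>g_separated\<close> enforces for N + 1
        separated points.\<close>
      define \<delta> where "\<delta> = C * \<eta> ^ N / 2"
      have \<delta>: "0 < \<delta>"
        using C \<eta> by (simp add: \<delta>_def)
      obtain I where I: "finite I" "card I = Suc N" "I \<subseteq> ?S \<delta>"
        using infinite_arbitrarily_large[OF inf[OF \<delta>]] by blast
      have "C * \<eta> ^ N \<le> \<delta>"
      proof (rule bound[OF _ \<eta>])
        show "card ((\<lambda>n. (f ^^ n) y) ` I) = Suc N"
          using I inj by (subst card_image) (auto intro: inj_on_subset)
      next
        fix x z assume "x \<in> (\<lambda>n. (f ^^ n) y) ` I" "z \<in> (\<lambda>n. (f ^^ n) y) ` I" "x \<noteq> z"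
        then obtain m n where "x = (f ^^ m) y" "z = (f ^^ n) y" "n \<noteq> m"
          by auto
        then show "\<eta> \<le> av (x - z)"
          using sep by simp
      qed (use I g_orbit[OF y] orbit_sphere[OF y] in \<open>auto intro: less_imp_le\<close>)
      then show False
        using C \<eta> by (simp add: \<delta>_def)
    qed
  qed
  have "\<exists>n. av (lam ^ n * g y - g u) < inverse (real (Suc k))" for k
    using dense[of "inverse (real (Suc k))"] by simp
  then obtain \<nu> where \<nu>: "\<And>k. av (lam ^ \<nu> k * g y - g u) < inverse (real (Suc k))"
    by metis
  \<comment> \<open>Orbit points whose g-values tend to g(u). Total boundedness and completeness
    give a subsequence with limit \<open>e\<close>, and \<open>e\<close> lies in the ball through
    \<open>y\<close>, hence in \<open>D\<close>, where injectivity identifies it with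
    \<open>u\<close>.\<close>
  define \<sigma> where "\<sigma> k = (f ^^ \<nu> k) y" for k
  have "range \<sigma> \<subseteq> range (\<lambda>n. (f ^^ n) y)"
    by (auto simp: \<sigma>_def)
  then obtain q where q: "strict_mono q" "MCauchy (\<sigma> \<circ> q)"
    using orbit_totally_bounded[OF y rec] unfolding mtotally_bounded_sequentially by blast
  then obtain e where "limitin (ktop av) (\<sigma> \<circ> q) e sequentially"
    using complete unfolding mcomplete_def ktop_def by blast
  then have e: "conv (\<sigma> \<circ> q) e"
    by (simp add: limitin_iff_conv)
  have sphere: "av (\<sigma> k - x0) = av (y - x0)" for k
    by (simp add: \<sigma>_def orbit_sphere[OF y])
  have e_ball: "av (e - x0) \<le> av (y - x0)"
    by (rule conv_av_le[OF conv_diff[OF e conv_const]]) (simp add: sphere)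
  obtain C where C: "0 < C" and lip: "\<And>x x'. av (x - x0) \<le> av (y - x0) \<Longrightarrow>
      av (x' - x0) \<le> av (y - x0) \<Longrightarrow> av (g x - g x') \<le> C * av (x - x')"
    using g_lipschitz[OF yD] by blast
  have "conv (\<lambda>k. g ((\<sigma> \<circ> q) k)) (g e)"
    unfolding conv_def
  proof (rule Lim_null_comparison)
    show "\<forall>\<^sub>F k in sequentially. norm (av (g ((\<sigma> \<circ> q) k) - g e)) \<le> C * av ((\<sigma> \<circ> q) k - e)"
      using lip[OF _ e_ball] by (simp add: sphere)
    show "(\<lambda>k. C * av ((\<sigma> \<circ> q) k - e)) \<longlonglongrightarrow> 0"
      using tendsto_mult_right_zero[OF e[unfolded conv_def]] .
  qed
  moreover have "conv (\<lambda>k. g ((\<sigma> \<circ> q) k)) (g u)"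
    unfolding conv_def
  proof (rule Lim_null_comparison)
    show "\<forall>\<^sub>F k in sequentially. norm (av (g ((\<sigma> \<circ> q) k) - g u)) \<le> inverse (real (Suc (q k)))"
      using \<nu> by (auto simp: \<sigma>_def g_orbit[OF y] intro!: always_eventually less_imp_le)
    show "(\<lambda>k. inverse (real (Suc (q k)))) \<longlonglongrightarrow> 0"
      using LIMSEQ_subseq_LIMSEQ[OF LIMSEQ_inverse_real_of_nat q(1)] by (simp add: o_def)
  qed
  ultimately have "g e = g u"
    by (rule conv_unique)
  then have "e = u"
    using inj_onD[OF g_inj] in_disc[OF yD e_ball] u X_subset by blast
  then have "eventually (\<lambda>k. av ((\<sigma> \<circ> q) k - u) < \<epsilon>) sequentially"
    using order_tendstoD(2)[OF e[unfolded conv_def] \<open>0 < \<epsilon>\<close>] by simp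
  then show ?thesis
    using eventually_happens'[OF sequentially_bot] by (fastforce simp: \<sigma>_def)
qed

lemma transitive_preimage:
  assumes "transitive_on av (\<lambda>z. lam * z) (g ` X)"
  shows "transitive_on av f X"
proof -
  obtain y where "y \<in> X" and "\<forall>u\<in>X. \<forall>\<epsilon>>0. \<exists>n. av (lam ^ n * g y - g u) < \<epsilon>"
    using assms unfolding transitive_on_def mem_closure_iff subset_iff funpow_mult_left by blast
  then show ?thesis
    unfolding transitive_on_iff using orbit_dense_lift by blast
qed

section \<open>Recurrence, minimality and surjectivity on compact invariant sets\<close>

lemma compact_recurrent:
  assumes X: "compactin (ktop av) X" and y: "y \<in> X" and "0 < \<epsilon>"
  shows "\<exists>m>0. av ((f ^^ m) y - y) < \<epsilon>"
proof -
  have "mtotally_bounded X"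
    using X compactin_imp_mtotally_bounded unfolding ktop_def by blast
  moreover have "range (\<lambda>n. (f ^^ n) y) \<subseteq> X"
    using orbit_in[OF y] by blast
  ultimately obtain q where q: "strict_mono q" "MCauchy ((\<lambda>n. (f ^^ n) y) \<circ> q)"
    unfolding mtotally_bounded_sequentially by blast
  \<comment> \<open>Two orbit points close to each other suffice: the isometry cancels the smaller
    iterate, and the difference of the indices is a return time of \<open>y\<close>.\<close>
  obtain k where k: "\<forall>n n'. k \<le> n \<longrightarrow> k \<le> n' \<longrightarrow> av ((f ^^ q n) y - (f ^^ q n') y) < \<epsilon>"
    using conjunct2[OF q(2)[unfolded MCauchy_def kdist_def comp_apply], rule_format, OF \<open>0 < \<epsilon>\<close>] ..
  have less: "q k < q (Suc k)"
    using q(1) by (simp add: strict_mono_def)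
  then have "(f ^^ q (Suc k)) y = (f ^^ q k) ((f ^^ (q (Suc k) - q k)) y)"
    using funpow_add[of "q k" "q (Suc k) - q k" f] by simp
  then have "av ((f ^^ (q (Suc k) - q k)) y - y) < \<epsilon>"
    using k[rule_format, of "Suc k" k]
      orbit_isometry[OF orbit_in[OF y, of "q (Suc k) - q k"] y, of "q k"] by simp
  with less show ?thesis by (intro exI[of _ "q (Suc k) - q k"]) simp
qed

text \<open>Multiples of a return time are again return times for the same
  \<open>\<epsilon>\<close>, by isometry and the ultrametric inequality; \<open>k * m\<close> is
  late enough.\<close>

lemma recurrent_late:
  assumes y: "y \<in> X" and rec: "\<exists>m>0. av ((f ^^ m) y - y) < \<epsilon>"
  shows "\<exists>m\<ge>k. av ((f ^^ m) y - y) < \<epsilon>"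
proof -
  obtain m where m: "0 < m" "av ((f ^^ m) y - y) < \<epsilon>"
    using rec by blast
  have "av ((f ^^ (i * m)) y - y) < \<epsilon>" for i
  proof (induction i)
    case 0
    then show ?case
      using m av_nonneg[of "(f ^^ m) y - y"] by (simp del: av_nonneg)
  next
    case (Suc i)
    have "(f ^^ (Suc i * m)) y = (f ^^ m) ((f ^^ (i * m)) y)"
      using funpow_add[of m "i * m" f] by simp
    then have "av ((f ^^ (Suc i * m)) y - (f ^^ m) y) < \<epsilon>"
      using orbit_isometry[OF orbit_in[OF y, of "i * m"] y, of m] Suc by simp
    with m av_triangle[of "(f ^^ (Suc i * m)) y" y "(f ^^ m) y"] show ?case by simp
  qed
  moreover have "k \<le> k * m"
    using m by simp
  ultimately show ?thesis by blast
qed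

text \<open>First wait for a late return to \<open>y\<close>, then follow the approach to
  \<open>v\<close>: f^n carries the point near \<open>y\<close> to one near f^n(y).\<close>

lemma compact_orbit_late:
  assumes X: "compactin (ktop av) X" and y: "y \<in> X"
    and dense: "\<And>\<epsilon>. 0 < \<epsilon> \<Longrightarrow> \<exists>n. av ((f ^^ n) y - v) < \<epsilon>" and \<epsilon>: "0 < \<epsilon>"
  shows "\<exists>n\<ge>k. av ((f ^^ n) y - v) < \<epsilon>"
proof -
  obtain n where n: "av ((f ^^ n) y - v) < \<epsilon>"
    using dense \<epsilon> by blast
  obtain m where m: "k \<le> m" "av ((f ^^ m) y - y) < \<epsilon>"
    using recurrent_late[OF y compact_recurrent[OF X y \<epsilon>]] by blast
  have "(f ^^ (n + m)) y = (f ^^ n) ((f ^^ m) y)"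
    using funpow_add[of n m f] by simp
  then have "av ((f ^^ (n + m)) y - (f ^^ n) y) < \<epsilon>"
    using orbit_isometry[OF orbit_in[OF y, of m] y, of n] m by simp
  with n m av_triangle[of "(f ^^ (n + m)) y" v "(f ^^ n) y"] show ?thesis
    by (intro exI[of _ "n + m"]) auto
qed

text \<open>If f^k(y) is near \<open>u\<close> and f^n(y) is near \<open>v\<close> with n \<ge> k,
  then by isometry f^(n-k)(u) is near \<open>v\<close>. Recurrence provides such a late
  \<open>n\<close>.\<close>

lemma compact_transitive_minimal:
  assumes X: "compactin (ktop av) X" and trans: "transitive_on av f X"
  shows "minimal_on av f X"
proof -
  obtain y where y: "y \<in> X" and dense: "\<And>u \<epsilon>. u \<in> X \<Longrightarrow> 0 < \<epsilon> \<Longrightarrow> \<exists>n. av ((f ^^ n) y - u) < \<epsilon>"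
    using trans unfolding transitive_on_iff by blast
  have "\<exists>n. av ((f ^^ n) u - v) < \<epsilon>" if u: "u \<in> X" and v: "v \<in> X" and \<epsilon>: "0 < \<epsilon>" for u v \<epsilon>
  proof -
    obtain k where k: "av ((f ^^ k) y - u) < \<epsilon>"
      using dense[OF u \<epsilon>] by blast
    obtain n where n: "k \<le> n" "av ((f ^^ n) y - v) < \<epsilon>"
      using compact_orbit_late[OF X y dense[OF v] \<epsilon>] by blast
    have "(f ^^ n) y = (f ^^ (n - k)) ((f ^^ k) y)"
      using n funpow_add[of "n - k" k f] by simp
    then have "av ((f ^^ (n - k)) u - (f ^^ n) y) < \<epsilon>"
      using orbit_isometry[OF u orbit_in[OF y, of k], of "n - k"] k av_commute[of u] by simp
    with n av_triangle[of "(f ^^ (n - k)) u" v "(f ^^ n) y"] show ?thesis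
      by (intro exI[of _ "n - k"]) auto
  qed
  then show ?thesis
    unfolding minimal_on_def mem_closure_iff subset_iff by blast
qed

text \<open>Orbit points of index at least 1 lie in f(X) and approximate \<open>v\<close>. Their
  preimages in \<open>X\<close> have a cluster point by compactness, and continuity of
  \<open>f\<close> maps it to \<open>v\<close>.\<close>

lemma compact_transitive_surj:
  assumes X: "compactin (ktop av) X" and trans: "transitive_on av f X"
  shows "f ` X = X"
proof
  obtain y where y: "y \<in> X" and dense: "\<And>u \<epsilon>. u \<in> X \<Longrightarrow> 0 < \<epsilon> \<Longrightarrow> \<exists>n. av ((f ^^ n) y - u) < \<epsilon>"
    using trans unfolding transitive_on_iff by blast
  show "X \<subseteq> f ` X"
  proof
    fix v assume v: "v \<in> X"
    have "\<exists>w\<in>X. av (f w - v) < inverse (real (Suc k))" for k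
    proof -
      obtain n where n: "1 \<le> n" "av ((f ^^ n) y - v) < inverse (real (Suc k))"
        using compact_orbit_late[OF X y dense[OF v], of "inverse (real (Suc k))" 1] by auto
      then obtain m where "n = Suc m"
        by (cases n) auto
      with n orbit_in[OF y, of m] show ?thesis by auto
    qed
    then obtain w where w: "\<And>k. w k \<in> X" "\<And>k. av (f (w k) - v) < inverse (real (Suc k))"
      by metis
    then have "range w \<subseteq> X" by blast
    then obtain e q where e: "e \<in> X" "strict_mono q" "limitin (ktop av) (w \<circ> q) e sequentially"
      using X unfolding ktop_def compactin_sequentially by blast
    have "conv (\<lambda>k. f ((w \<circ> q) k)) (f e)"
      using e w(1) X_subset unfolding limitin_iff_conv conv_def
      by (subst f_isometry) auto
    moreover have "conv (\<lambda>k. f ((w \<circ> q) k)) v"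
      unfolding conv_def
    proof (rule Lim_null_comparison)
      show "\<forall>\<^sub>F k in sequentially. norm (av (f ((w \<circ> q) k) - v)) \<le> inverse (real (Suc (q k)))"
        using w(2) by (auto intro!: always_eventually less_imp_le)
      show "(\<lambda>k. inverse (real (Suc (q k)))) \<longlonglongrightarrow> 0"
        using LIMSEQ_subseq_LIMSEQ[OF LIMSEQ_inverse_real_of_nat e(2)] by (simp add: o_def)
    qed
    ultimately have "f e = v"
      by (rule conv_unique)
    with e show "v \<in> f ` X" by blast
  qed
qed (rule f_X)

end

theorem theoremG:
  fixes av :: "'a::field \<Rightarrow> real"
    and a b :: "nat \<Rightarrow> 'a"
    and x0 lam :: 'a
    and D X :: "'a set"
  assumes K: "complete_nonarch av"
    and f0: "a 0 = x0" and f1: "a 1 = lam"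
    and lam_abs: "av lam = 1"
    and lam_nonroot: "\<forall>n::nat. n > 0 \<longrightarrow> lam ^ n \<noteq> 1"
    and g0: "b 0 = 0" and g1: "av (b 1) = 1"
    and D: "lin_disc av a b x0 lam D"
    and XD: "X \<subseteq> D"
    and fX: "ps_eval av a x0 ` X \<subseteq> X"
  shows "(transitive_on av (ps_eval av a x0) X \<longleftrightarrow>
            transitive_on av (\<lambda>z. lam * z) (ps_eval av b x0 ` X))
       \<and> (compactin (ktop av) X \<and> transitive_on av (ps_eval av a x0) X \<longrightarrow>
            minimal_on av (ps_eval av a x0) X \<and> ps_eval av a x0 ` X = X \<and>
            ps_eval av b x0 ` X = (\<lambda>z. lam * z) ` (ps_eval av b x0 ` X))"
proof -
  interpret nonarch_field av
    using K by unfold_locales (simp add: complete_nonarch_def)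
  interpret linearized_orbits av a b x0 lam D X
  proof unfold_locales
    show "mcomplete"
      using K by (simp add: complete_nonarch_def)
    show "b 1 \<noteq> 0"
      using g1 by auto
  qed (use assms in \<open>auto simp: lin_disc_def\<close>)
  have "g ` X = (\<lambda>z. lam * z) ` (g ` X)" if "f ` X = X"
  proof -
    have "g ` X = g ` (f ` X)"
      using that by simp
    also have "\<dots> = (\<lambda>z. lam * z) ` (g ` X)"
      unfolding image_image using X_subset by (intro image_cong) (auto simp: g_f)
    finally show ?thesis .
  qed
  then show ?thesis
    using transitive_image transitive_preimage compact_transitive_minimal compact_transitive_surj
    by blast
qed

end
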